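(* Let $q\in(0,1)$ and let $\ell^1(h)$ be the $L^1$-algebra associated with the little $q$-Legendre polynomials $(R_n(x;q))_{n\in\mathbb{N}_0}$. Then $\ell^1(h)$ is weakly amenable, i.e. every bounded derivation from $\ell^1(h)$ into its dual module is an inner derivation.
   Context: For $q\in(0,1)$, the little $q$-Legendre polynomials are defined by $R_0(x;q)=1$, $R_1(x;q)=(x-b_0)/a_0$ and $R_1(x;q)R_n(x;q)=a_nR_{n+1}(x;q)+b_nR_n(x;q)+c_nR_{n-1}(x;q)$ for $n\ge1$, where $a_0=\frac{1}{q+1}$, $b_0=\frac{q}{q+1}$, and for $n\ge1$: $a_n=q^n\frac{(1+q)(1-q^{n+1})}{(1-q^{2n+1})(1+q^{n+1})}$, $c_n=q^n\frac{(1+q)(1-q^n)}{(1-q^{2n+1})(1+q^n)}$, $b_n=1-a_n-c_n$. One has linearization formulas $R_m(x;q)R_n(x;q)=\sum_{k=|m-n|}^{m+n}g(m,n;k)R_k(x;q)$ with $g(m,n;k)\ge0$. Let $h(n)=\frac{1}{q^n}\frac{1-q^{2n+1}}{1-q}$. For $f:\mathbb{N}_0\to\mathbb{C}$ let $T_nf(m)=\sum_{k=|m-n|}^{m+n}g(m,n;k)f(k)$. The space $\ell^1(h)=\{f:\mathbb{N}_0\to\mathbb{C}:\sum_k|f(k)|h(k)<\infty\}$ with the convolution $f\ast g(n)=\sum_{k=0}^\infty T_nf(k)g(k)h(k)$ is a commutative unital Banach algebra; its dual module is $\ell^\infty$, on which $\ell^1(h)$ acts by the same convolution formula. A derivation $D:A\to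 X$ into a Banach $A$-bimodule satisfies $D(ab)=a\cdot D(b)+D(a)\cdot b$; it is inner if $D(a)=a\cdot x-x\cdot a$ for some $x\in X$ (for the commutative algebra $\ell^1(h)$ acting on $\ell^\infty$, inner derivations are zero). *)

theory Defs
  imports "HOL-Analysis.Analysis" "HOL-Computational_Algebra.Polynomial"
begin

definition qL_a :: "real \<Rightarrow> nat \<Rightarrow> real" where
  "qL_a q n = (if n = 0 then 1 / (q + 1)
     else q ^ n * ((1 + q) * (1 - q ^ (n + 1))) / ((1 - q ^ (2 * n + 1)) * (1 + q ^ (n + 1))))"

definition qL_c :: "real \<Rightarrow> nat \<Rightarrow> real" where
  "qL_c q n = (if n = 0 then 0
     else q ^ n * ((1 + q) * (1 - q ^ n)) / ((1 - q ^ (2 * n + 1)) * (1 + q ^ n)))"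

definition qL_b :: "real \<Rightarrow> nat \<Rightarrow> real" where
  "qL_b q n = (if n = 0 then q / (q + 1) else 1 - qL_a q n - qL_c q n)"

text \<open>R_0 = 1, R_1 = (x - b_0)/a_0, and for n \<ge> 1:
  R_1 R_n = a_n R_(n+1) + b_n R_n + c_n R_(n-1), solved for R_(n+1).\<close>
fun qLeg :: "real \<Rightarrow> nat \<Rightarrow> real poly" where
  "qLeg q 0 = 1"
| "qLeg q (Suc 0) = [: - qL_b q 0 / qL_a q 0, 1 / qL_a q 0 :]"
| "qLeg q (Suc (Suc n)) =
     smult (1 / qL_a q (Suc n))
       (qLeg q 1 * qLeg q (Suc n) - smult (qL_b q (Suc n)) (qLeg q (Suc n))
          - smult (qL_c q (Suc n)) (qLeg q n))"

text \<open>Linearization coefficients: R_m R_n = \<Sum>_(k\<le>m+n) g(m,n;k) R_k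
  (the coefficients are unique since deg R_k = k).\<close>
definition lin_coeff :: "real \<Rightarrow> nat \<Rightarrow> nat \<Rightarrow> nat \<Rightarrow> real" where
  "lin_coeff q m n = (THE c. (\<forall>k. c k \<noteq> 0 \<longrightarrow> k \<le> m + n) \<and>
      qLeg q m * qLeg q n = (\<Sum>k\<le>m + n. smult (c k) (qLeg q k)))"

definition qL_h :: "real \<Rightarrow> nat \<Rightarrow> real" where
  "qL_h q n = (1 / q ^ n) * ((1 - q ^ (2 * n + 1)) / (1 - q))"

definition transl :: "real \<Rightarrow> nat \<Rightarrow> (nat \<Rightarrow> complex) \<Rightarrow> nat \<Rightarrow> complex" where
  "transl q n f m = (\<Sum>k \<in> {(if m \<le> n then n - m else m - n) .. m + n}.
      complex_of_real (lin_coeff q m n k) * f k)"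

definition l1h :: "real \<Rightarrow> (nat \<Rightarrow> complex) set" where
  "l1h q = {f. summable (\<lambda>k. norm (f k) * qL_h q k)}"

definition l1h_norm :: "real \<Rightarrow> (nat \<Rightarrow> complex) \<Rightarrow> real" where
  "l1h_norm q f = (\<Sum>k. norm (f k) * qL_h q k)"

definition linfty :: "(nat \<Rightarrow> complex) set" where
  "linfty = {\<phi>. bounded (range \<phi>)}"

text \<open>Convolution f * g (n) = \<Sum>_k T_n f(k) g(k) h(k); used both for the algebra product
  and for the (two-sided) module action of l^1(h) on l^\<infinity>.\<close>
definition conv :: "real \<Rightarrow> (nat \<Rightarrow> complex) \<Rightarrow> (nat \<Rightarrow> complex) \<Rightarrow> nat \<Rightarrow> complex" where
  "conv q f g n = (\<Sum>k. transl q n f k * g k * complex_of_real (qL_h q k))"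

definition bounded_derivation_l1h :: "real \<Rightarrow> ((nat \<Rightarrow> complex) \<Rightarrow> (nat \<Rightarrow> complex)) \<Rightarrow> bool" where
  "bounded_derivation_l1h q D \<longleftrightarrow>
     (\<forall>f \<in> l1h q. D f \<in> linfty) \<and>
     (\<forall>f \<in> l1h q. \<forall>g \<in> l1h q. D (\<lambda>k. f k + g k) = (\<lambda>k. D f k + D g k)) \<and>
     (\<forall>f \<in> l1h q. \<forall>c::complex. D (\<lambda>k. c * f k) = (\<lambda>k. c * D f k)) \<and>
     (\<exists>C. \<forall>f \<in> l1h q. \<forall>n. norm (D f n) \<le> C * l1h_norm q f) \<and>
     (\<forall>f \<in> l1h q. \<forall>g \<in> l1h q. D (conv q f g) = (\<lambda>n. conv q f (D g) n + conv q (D f) g n))"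

definition inner_derivation_l1h :: "real \<Rightarrow> ((nat \<Rightarrow> complex) \<Rightarrow> (nat \<Rightarrow> complex)) \<Rightarrow> bool" where
  "inner_derivation_l1h q D \<longleftrightarrow>
     (\<exists>x \<in> linfty. \<forall>f \<in> l1h q. D f = (\<lambda>n. conv q f x n - conv q x f n))"

definition weakly_amenable_l1h :: "real \<Rightarrow> bool" where
  "weakly_amenable_l1h q \<longleftrightarrow>
     (\<forall>D. bounded_derivation_l1h q D \<longrightarrow> inner_derivation_l1h q D)"

end

theory Submission
  imports Defs
begin

text \<open>
  Write \<open>P n k\<close> for the value of \<open>R\<^sub>n\<close> at the point \<open>1 - q\<^sup>k\<close>. These points carry the
  orthogonality measure, with weights \<open>(1 - q) q\<^sup>k\<close>: a \<open>q\<close>-difference equation in \<open>k\<close> makes the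
  \<open>R\<^sub>n\<close> eigenvectors of a symmetric operator with distinct eigenvalues. The functions
  \<open>e\<^sub>k = (\<lambda>n. P n k)\<close> lie in \<open>\<ell>\<^sup>1(h)\<close>, are up to scalars idempotents, and satisfy
  \<open>e\<^sub>k * \<phi> = \<langle>\<phi>, e\<^sub>k\<rangle> e\<^sub>k\<close> for bounded \<open>\<phi>\<close>, so a derivation vanishes on each of them and on the
  unit \<open>\<epsilon>\<^sub>0\<close>. Although \<open>\<epsilon>\<^sub>n = (1 - q) \<Sum>\<^sub>k q\<^sup>k P n k e\<^sub>k\<close> need not converge absolutely in norm,
  \<open>\<epsilon>\<^sub>n - \<epsilon>\<^sub>0 = (1 - q) \<Sum>\<^sub>k q\<^sup>k (P n k - 1) e\<^sub>k\<close> does, because \<open>P n k - 1 = O(q\<^sup>k)\<close>. By continuity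
  the derivation vanishes on every \<open>\<epsilon>\<^sub>n\<close>, hence on their closed span, which is all of \<open>\<ell>\<^sup>1(h)\<close>.
\<close>

locale little_q_Legendre =
  fixes q :: real
  assumes q_pos: "0 < q" and q_less_1: "q < 1"
begin

text \<open>
  \<open>A\<close> and \<open>C\<close> are \<open>a\<^sub>n\<close> and \<open>c\<^sub>n\<close> for \<open>n \<ge> 1\<close>, but \<open>A 0 = 1\<close> and \<open>C 0 = 0\<close>, so that the recurrence
  for \<open>R\<^sub>1 R\<^sub>n\<close> also holds for \<open>n = 0\<close>.
\<close>

definition A :: "nat \<Rightarrow> real" where
  "A n = q ^ n * ((1 + q) * (1 - q * q ^ n)) / ((1 - q * (q ^ n)\<^sup>2) * (1 + q * q ^ n))"

definition C :: "nat \<Rightarrow> real" where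
  "C n = q ^ n * ((1 + q) * (1 - q ^ n)) / ((1 - q * (q ^ n)\<^sup>2) * (1 + q ^ n))"

abbreviation R :: "nat \<Rightarrow> real poly" where
  "R \<equiv> qLeg q"

abbreviation h :: "nat \<Rightarrow> real" where
  "h \<equiv> qL_h q"

definition P :: "nat \<Rightarrow> nat \<Rightarrow> real" where
  "P n k = poly (R n) (1 - q ^ k)"

section \<open>Elementary bounds for the coefficients and the weights\<close>

lemma q_nonzero [simp]: "q \<noteq> 0"
  using q_pos by simp

lemma q_power_pos: "0 < q ^ n"
  using q_pos by simp

lemma q_power_le_1: "q ^ n \<le> 1"
  using q_pos q_less_1 by (simp add: power_le_one)

lemma q_power_Suc_less_1: "q * q ^ n < 1"
  using mult_left_mono[OF q_power_le_1[of n] less_imp_le[OF q_pos]] q_less_1 by linarith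

lemma one_minus_q_le: "1 - q \<le> 1 - q * (q ^ n)\<^sup>2"
  using q_pos q_power_le_1[of n] q_power_pos[of n]
  by (simp add: power_le_one)

lemma h_denominator_pos: "0 < 1 - q * (q ^ n)\<^sup>2"
  using one_minus_q_le[of n] q_less_1 by linarith

lemma q_power_odd: "q ^ (2 * n + 1) = q * (q ^ n)\<^sup>2"
  by (simp add: mult.commute[of 2] flip: power_mult)

lemma h_eq: "h n = (1 - q * (q ^ n)\<^sup>2) / (q ^ n * (1 - q))"
  unfolding qL_h_def q_power_odd by simp

lemma h_pos: "0 < h n"
  unfolding h_eq using h_denominator_pos[of n] q_power_pos[of n] q_less_1 by simp

lemma h_0: "h 0 = 1"
  using q_less_1 by (simp add: h_eq)

lemma h_le: "h n \<le> 1 / ((1 - q) * q ^ n)"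
proof -
  have "1 - q * (q ^ n)\<^sup>2 \<le> 1" using q_pos by simp
  then show ?thesis unfolding h_eq using q_power_pos[of n] q_less_1
    by (simp add: divide_simps)
qed

lemma A_0: "A 0 = 1" and C_0: "C 0 = 0"
  using q_pos q_less_1 by (auto simp: A_def C_def)

lemma A_pos: "0 < A n"
  unfolding A_def using h_denominator_pos[of n] q_power_pos[of n] q_pos q_power_Suc_less_1[of n]
  by (intro divide_pos_pos mult_pos_pos) (auto intro: add_pos_pos)

lemma C_nonneg: "0 \<le> C n"
  unfolding C_def using h_denominator_pos[of n] q_power_pos[of n] q_pos q_power_le_1[of n]
  by (intro divide_nonneg_pos mult_nonneg_nonneg mult_pos_pos) (auto intro: add_pos_pos)

text \<open>\<open>A n\<close>, \<open>C n\<close> and \<open>h n * A n\<close> all have this shape;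
  the constant comes from \<open>1 + q \<le> 2\<close>.\<close>

lemma coefficient_bound:
  assumes "0 \<le> N" "0 \<le> x" "x \<le> 1" "1 - q \<le> d" "1 \<le> y"
  shows "N * ((1 + q) * x) / (d * y) \<le> 2 / (1 - q) * N"
proof -
  have "(1 + q) * x \<le> 2 * 1"
    using assms q_pos q_less_1 by (intro mult_mono) linarith+
  then have num: "N * ((1 + q) * x) \<le> N * 2"
    using assms by (intro mult_left_mono) simp_all
  have "(1 - q) * 1 \<le> d * y"
    using assms q_less_1 by (intro mult_mono) linarith+
  then have "N * ((1 + q) * x) / (d * y) \<le> N * 2 / (1 - q)"
    using num assms q_less_1 by (intro frac_le) simp_all
  then show ?thesis by (simp add: mult.commute)
qed

lemma A_le: "A n \<le> 2 / (1 - q) * q ^ n"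
  unfolding A_def using q_power_pos[of n] q_power_pos[of "Suc n"] q_power_Suc_less_1[of n] one_minus_q_le[of n]
  by (intro coefficient_bound) simp_all

lemma C_le: "C n \<le> 2 / (1 - q) * q ^ n"
  unfolding C_def using q_power_pos[of n] q_power_le_1[of n] one_minus_q_le[of n]
  by (intro coefficient_bound) simp_all

lemma h_A_eq: "h n * A n = (1 + q) * (1 - q * q ^ n) / ((1 - q) * (1 + q * q ^ n))"
  unfolding h_eq A_def using h_denominator_pos[of n] q_power_pos[of n] q_pos by simp

text \<open>Detailed balance: multiplication by \<open>R (Suc 0)\<close> is symmetric for the
  weights \<open>h\<close>. The norms of the \<open>R n\<close> and the summation by parts for
  \<open>transl\<close> rest on it.\<close>

lemma h_C_Suc: "h (Suc n) * C (Suc n) = h n * A n"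
proof -
  have "h (Suc n) * C (Suc n) = (1 + q) * (1 - q * q ^ n) / ((1 - q) * (1 + q * q ^ n))"
    unfolding h_eq C_def using h_denominator_pos[of "Suc n"] q_power_pos[of "Suc n"] q_pos
    by simp
  then show ?thesis by (simp add: h_A_eq)
qed

lemma h_A_le: "h n * A n \<le> 2 / (1 - q)"
  using coefficient_bound[of 1 "1 - q * q ^ n" "1 - q" "1 + q * q ^ n"]
    q_power_pos[of "Suc n"] q_power_Suc_less_1[of n]
  by (simp add: h_A_eq)

subsection \<open>The recurrence and the $q$-difference equation\<close>

lemma R_1: "R (Suc 0) = [:- q, 1 + q:]"
  using q_pos by (simp add: qL_a_def qL_b_def add.commute)

text \<open>At \<open>n = 0\<close> the truncated \<open>n - 1\<close> is again \<open>0\<close>,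
  which is harmless because \<open>C 0 = 0\<close>.\<close>

lemma R_Suc_0_mult:
  "R (Suc 0) * R n = smult (A n) (R (Suc n)) + smult (1 - A n - C n) (R n) + smult (C n) (R (n - 1))"
proof (cases n)
  case 0
  then show ?thesis by (simp add: A_0 C_0 del: qLeg.simps(2))
next
  case (Suc m)
  have eqs: "qL_a q n = A n" "qL_c q n = C n" "qL_b q n = 1 - A n - C n"
    using Suc by (simp_all only: qL_a_def qL_c_def qL_b_def A_def C_def q_power_odd) simp_all
  show ?thesis using eqs A_pos[of n] unfolding Suc by (simp del: qLeg.simps(2))
qed

lemma degree_R: "degree (R n) = n"
proof (induction n rule: less_induct)
  case (less n)
  consider "n = 0" | "n = 1" | m where "n = Suc (Suc m)"
    by (metis One_nat_def not0_implies_Suc)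
  then show ?case
  proof cases
    case (3 m)
    have d: "degree (R (Suc m)) = Suc m" "degree (R m) = m"
      using less.IH 3 by auto
    have "R (Suc m) \<noteq> 0" using d(1) by auto
    then have "degree (R (Suc 0) * R (Suc m)) = Suc (Suc m)"
      using q_pos d by (subst degree_mult_eq) (auto simp: R_1 simp del: qLeg.simps)
    moreover have "smult (A (Suc m)) (R n)
        = R (Suc 0) * R (Suc m) - (smult (1 - A (Suc m) - C (Suc m)) (R (Suc m)) + smult (C (Suc m)) (R m))"
      using R_Suc_0_mult[of "Suc m"] 3 by (simp del: qLeg.simps)
    \<comment> \<open>These terms have too small a degree to cancel the leading term of the
      product.\<close>
    moreover have "degree (smult (1 - A (Suc m) - C (Suc m)) (R (Suc m)) + smult (C (Suc m)) (R m)) < Suc (Suc m)"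
      using d by (intro degree_add_less) (auto intro: le_less_trans[OF degree_smult_le] simp del: qLeg.simps)
    ultimately have "degree (smult (A (Suc m)) (R n)) = Suc (Suc m)"
      by (metis add_uminus_conv_diff degree_add_eq_left degree_minus)
    then show ?thesis using A_pos[of "Suc m"] 3 by (simp del: qLeg.simps)
  qed (use q_pos in \<open>auto simp: R_1 simp del: qLeg.simps(2)\<close>)
qed

lemma P_0 [simp]: "P 0 k = 1"
  by (simp add: P_def)

lemma P_1: "P (Suc 0) k = 1 - (1 + q) * q ^ k"
  by (simp add: P_def R_1 algebra_simps del: qLeg.simps)

lemma P_recurrence:
  "P (Suc 0) k * P n k = A n * P (Suc n) k + (1 - A n - C n) * P n k + C n * P (n - 1) k"
  using arg_cong[OF R_Suc_0_mult[of n], of "\<lambda>p. poly p (1 - q ^ k)"]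
  by (simp add: P_def del: qLeg.simps)

text \<open>Clearing denominators and cancelling \<open>1 + q\<close> leaves a polynomial identity
  in \<open>q\<close>, \<open>q ^ n\<close> and \<open>q ^ k\<close>, as the algebraic verification
  below requires.\<close>

lemma P_recurrence_cleared:
  assumes "n \<ge> 1"
  shows "q ^ n * (1 - q * q ^ n) * (1 + q ^ n) * P (Suc n) k =
    (2 * q ^ n * (1 - q * (q ^ n)\<^sup>2) - q ^ k * (1 - q * (q ^ n)\<^sup>2) * (1 + q * q ^ n) * (1 + q ^ n)) * P n k
     - q ^ n * (1 - q ^ n) * (1 + q * q ^ n) * P (n - 1) k"
proof -
  define N where "N = q ^ n"
  define D where "D = (1 - q * N\<^sup>2) * (1 + q * N) * (1 + N)"
  have N: "N > 0" "1 - q * N\<^sup>2 > 0" "1 + q * N > 0" "1 + N > 0"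
    using q_power_pos[of n] h_denominator_pos[of n] q_pos by (auto simp: N_def intro: add_pos_pos)
  have nz: "1 + q \<noteq> 0" using q_pos by simp
  have a: "D * A n = (1 + q) * (N * (1 - q * N) * (1 + N))"
    using N by (simp add: A_def D_def flip: N_def)
  have c: "D * C n = (1 + q) * (N * (1 - N) * (1 + q * N))"
    using N by (simp add: C_def D_def flip: N_def)
  \<comment> \<open>The coefficients of the recurrence sum to 1, so it can be written in
    differences; \<open>P (Suc 0) k - 1 = - (1 + q) * q ^ k\<close> then supplies the common factor
    \<open>1 + q\<close>.\<close>
  have "D * (P (Suc 0) k * P n k - P n k) = (D * A n) * (P (Suc n) k - P n k) + (D * C n) * (P (n - 1) k - P n k)"
    unfolding P_recurrence[of k n] by (simp add: algebra_simps)
  then have "(1 + q) * (D * (- (q ^ k) * P n k)) = (1 + q) * ((N * (1 - q * N) * (1 + N)) * (P (Suc n) k - P n k)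
      + (N * (1 - N) * (1 + q * N)) * (P (n - 1) k - P n k))"
    unfolding a c P_1 by (simp add: algebra_simps)
  then have "D * (- (q ^ k) * P n k) = (N * (1 - q * N) * (1 + N)) * (P (Suc n) k - P n k)
      + (N * (1 - N) * (1 + q * N)) * (P (n - 1) k - P n k)"
    using q_pos by (simp only: mult_left_cancel[OF nz])
  then show ?thesis unfolding D_def N_def[symmetric] by (simp add: algebra_simps power2_eq_square)
qed

text \<open>
  The \<open>q\<close>-difference equation does not pass through the recurrence by itself. Two first-order relations
  between \<open>P n k\<close>, \<open>P (n - 1) k\<close> and their shifts in \<open>k\<close>, whose sum is that equation, do.
  The next lemma is their induction step, with \<open>N = q\<^sup>n\<close>, \<open>K = q\<^sup>k\<close>, with \<open>v, u, U\<close> the values for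
  \<open>n - 1, n, n + 1\<close> at \<open>k\<close>, and with primes for the values at \<open>k + 1\<close>.
\<close>

lemma structure_relations_step:
  fixes N K u v u' v' U U' :: real
  assumes R: "N * (1 - q * N) * (1 + N) * U =
      (2 * N * (1 - q * N\<^sup>2) - K * (1 - q * N\<^sup>2) * (1 + q * N) * (1 + N)) * u - N * (1 - N) * (1 + q * N) * v"
    and R': "N * (1 - q * N) * (1 + N) * U' =
      (2 * N * (1 - q * N\<^sup>2) - q * K * (1 - q * N\<^sup>2) * (1 + q * N) * (1 + N)) * u' - N * (1 - N) * (1 + q * N) * v'"
    and S: "(1 + N) * N * (1 - q * K) * (u' - u) =
      - (1 + N) * (1 - N) * (1 - q * N) * K * u - N * (1 - N) * (u - v) + (1 + N) * (1 - N) * K * u"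
    and S': "(1 + N) * N * (1 - q * K) * (u - u') = N * (1 - N) * (u' - v') - (1 + N) * (1 - N) * (q * K) * u'"
    and G: "N * (1 - q * N) * (1 + N) \<noteq> 0"
  shows "(1 + q * N) * (q * N) * (1 - q * K) * (U' - U) =
      - (1 + q * N) * (1 - q * N) * (1 - q * (q * N)) * K * U - q * N * (1 - q * N) * (U - u)
       + (1 + q * N) * (1 - q * N) * K * U" (is "?l1 = ?r1")
    and "(1 + q * N) * (q * N) * (1 - q * K) * (U - U') =
      q * N * (1 - q * N) * (U' - u') - (1 + q * N) * (1 - q * N) * (q * K) * U'" (is "?l2 = ?r2")
proof -
  let ?G = "N * (1 - q * N) * (1 + N)"
  have v': "N * (1 - N) * v' = N * (1 - N) * u' - (1 + N) * (1 - N) * (q * K) * u' - (1 + N) * N * (1 - q * K) * (u - u')"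
    using S' by (simp add: algebra_simps)
  have v: "N * (1 - N) * v = (1 + N) * N * (1 - q * K) * (u' - u) + (1 + N) * (1 - N) * (1 - q * N) * K * u
      + N * (1 - N) * u - (1 + N) * (1 - N) * K * u"
    using S by (simp add: algebra_simps)
  have u': "(1 + N) * N * (1 - q * K) * u' = (1 + N) * N * (1 - q * K) * u
      - (1 + N) * (1 - N) * (1 - q * N) * K * u - N * (1 - N) * (u - v) + (1 + N) * (1 - N) * K * u"
    using S by (simp add: algebra_simps)
  \<comment> \<open>\<open>S'\<close> eliminates \<open>v'\<close>, so \<open>U'\<close> depends on
    \<open>u\<close> and \<open>u'\<close> only.\<close>
  have e1: "?G * U' = q * N\<^sup>2 * (1 + N) * (q * K * (1 + q * N) - 2) * u' + (1 + q * N) * (1 + N) * N * (1 - q * K) * u"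
  proof -
    have "?G * U' = (2 * N * (1 - q * N\<^sup>2) - q * K * (1 - q * N\<^sup>2) * (1 + q * N) * (1 + N)) * u'
        - (1 + q * N) * (N * (1 - N) * v')"
      using R' by (simp add: algebra_simps)
    then show ?thesis unfolding v' by algebra
  qed
  \<comment> \<open>With the factor \<open>1 - q * K\<close> present, \<open>S\<close> eliminates
    \<open>u'\<close> too, and the first goal becomes an identity in \<open>u\<close> and
    \<open>v\<close>. In the second goal \<open>v\<close> is eliminated instead, leaving
    \<open>u\<close> and \<open>u'\<close>.\<close>
  have e2: "(1 - q * K) * (?G * U') = q * N * (q * K * (1 + q * N) - 2) * ((1 + N) * N * (1 - q * K) * u')
      + (1 + q * N) * (1 + N) * N * (1 - q * K) * (1 - q * K) * u"
    unfolding e1 by algebra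
  have e3: "?G * U = (2 * N * (1 - q * N\<^sup>2) - K * (1 - q * N\<^sup>2) * (1 + q * N) * (1 + N)) * u
      - (1 + q * N) * (N * (1 - N) * v)"
    using R by (simp add: algebra_simps)
  have "?G * ?l1 = (1 + q * N) * (q * N) * ((1 - q * K) * (?G * U')) - (1 + q * N) * (q * N) * (1 - q * K) * (?G * U)"
    by algebra
  also have "\<dots> = - (1 + q * N) * (1 - q * N) * (1 - q * (q * N)) * K * (?G * U) - q * N * (1 - q * N) * (?G * U - ?G * u)
       + (1 + q * N) * (1 - q * N) * K * (?G * U)"
    unfolding e2 u' R by algebra
  also have "\<dots> = ?G * ?r1"
    by algebra
  finally show "?l1 = ?r1" by (simp only: mult_left_cancel[OF G])
  have "?G * ?l2 = (1 + q * N) * (q * N) * (1 - q * K) * (?G * U - ?G * U')"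
    by algebra
  also have "\<dots> = q * N * (1 - q * N) * (?G * U' - ?G * u') - (1 + q * N) * (1 - q * N) * (q * K) * (?G * U')"
    unfolding e1 e3 v by algebra
  also have "\<dots> = ?G * ?r2"
    by algebra
  finally show "?l2 = ?r2" by (simp only: mult_left_cancel[OF G])
qed

text \<open>One induction carries both relations, since each new one needs both old ones.\<close>

lemma structure_relations:
  "(1 + q ^ Suc n) * q ^ Suc n * (1 - q * q ^ k) * (P (Suc n) (Suc k) - P (Suc n) k) =
     - (1 + q ^ Suc n) * (1 - q ^ Suc n) * (1 - q * q ^ Suc n) * q ^ k * P (Suc n) k
     - q ^ Suc n * (1 - q ^ Suc n) * (P (Suc n) k - P n k) + (1 + q ^ Suc n) * (1 - q ^ Suc n) * q ^ k * P (Suc n) k \<and>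
   (1 + q ^ Suc n) * q ^ Suc n * (1 - q * q ^ k) * (P (Suc n) k - P (Suc n) (Suc k)) =
     q ^ Suc n * (1 - q ^ Suc n) * (P (Suc n) (Suc k) - P n (Suc k))
     - (1 + q ^ Suc n) * (1 - q ^ Suc n) * (q * q ^ k) * P (Suc n) (Suc k)"
proof (induction n)
  case 0
  show ?case by (simp add: P_1 algebra_simps)
next
  case (Suc n)
  have G: "q ^ Suc n * (1 - q * q ^ Suc n) * (1 + q ^ Suc n) \<noteq> 0"
    using q_power_pos[of "Suc n"] q_power_Suc_less_1[of "Suc n"] by simp
  note R = P_recurrence_cleared[of "Suc n" k, simplified diff_Suc_1, OF le_add1[of 1 n, unfolded plus_1_eq_Suc]]
  note R' = P_recurrence_cleared[of "Suc n" "Suc k", simplified diff_Suc_1 power_Suc[of q k], OF le_add1[of 1 n, unfolded plus_1_eq_Suc]]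
  show ?case
    using structure_relations_step[OF R R' Suc[THEN conjunct1] Suc[THEN conjunct2] G]
    unfolding power_Suc[of q "Suc n"] by blast
qed

text \<open>The node \<open>k = 0\<close> is the point 0 and has no left neighbour at which to use
  the second structure relation. This first-order recursion in \<open>n\<close> takes its
  place.\<close>

lemma P_Suc_0_eq: "P (Suc n) 0 = - (q ^ Suc n) * P n 0"
proof (induction n)
  case 0
  then show ?case by (simp add: P_1)
next
  case (Suc n)
  define N where "N = q ^ Suc n"
  have pos: "N > 0" "1 - q * N > 0" "1 + N > 0" "1 + q * N > 0"
    using q_power_pos[of "Suc n"] q_power_Suc_less_1[of "Suc n"] q_pos
    by (auto simp: N_def intro: add_pos_pos)
  have "N * (1 - q * N) * (1 + N) * P (Suc (Suc n)) 0 =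
    (2 * N * (1 - q * N\<^sup>2) - (1 - q * N\<^sup>2) * (1 + q * N) * (1 + N)) * P (Suc n) 0 - N * (1 - N) * (1 + q * N) * P n 0"
    using P_recurrence_cleared[of "Suc n" 0] unfolding N_def by simp
  also have "N * (1 - N) * (1 + q * N) * P n 0 = - (1 - N) * (1 + q * N) * P (Suc n) 0"
    unfolding Suc N_def by algebra
  finally have "(N * (1 - q * N) * (1 + N)) * P (Suc (Suc n)) 0 = (N * (1 - q * N) * (1 + N)) * (- (q * N) * P (Suc n) 0)"
    by algebra
  moreover have nz: "N * (1 - q * N) * (1 + N) \<noteq> 0" using pos by simp
  ultimately have "P (Suc (Suc n)) 0 = - (q * N) * P (Suc n) 0" by (simp only: mult_left_cancel[OF nz])
  then show ?case by (simp add: N_def)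
qed

text \<open>Up to sign, the eigenvalues of the \<open>q\<close>-difference operator; divided by
  \<open>(1 - q) ^ 2\<close> they are \<open>q\<close>-analogues of the Legendre eigenvalues
  \<open>n * (n + 1)\<close>.\<close>

definition eigval :: "nat \<Rightarrow> real" where
  "eigval n = (1 - q ^ n) * (1 - q * q ^ n) / q ^ n"

text \<open>At the left end the backward difference drops out, as its coefficient
  \<open>1 - q ^ k\<close> vanishes at \<open>k = 0\<close>.\<close>

lemma P_difference_0: "(1 - q) * (P n 1 - P n 0) = - eigval n * P n 0"
proof (cases n)
  case 0
  then show ?thesis by (simp add: eigval_def)
next
  case (Suc m)
  define N where "N = q ^ n"
  have N: "N > 0" "1 + N > 0"
    using q_power_pos[of n] by (auto simp: N_def intro: add_pos_pos)
  have l: "N * eigval n = (1 - N) * (1 - q * N)"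
    using N unfolding eigval_def N_def by simp
  have "(1 + N) * N * ((1 - q) * (P n 1 - P n 0)) =
      - (1 + N) * (1 - N) * (1 - q * N) * P n 0 - N * (1 - N) * (P n 0 - P m 0) + (1 + N) * (1 - N) * P n 0"
    using structure_relations[of m 0] by (simp add: Suc N_def algebra_simps)
  moreover have "P n 0 = - N * P m 0"
    using P_Suc_0_eq[of m] by (simp add: Suc N_def)
  ultimately have "(1 + N) * N * ((1 - q) * (P n 1 - P n 0)) = (1 + N) * (- (N * eigval n) * P n 0)"
    unfolding l by algebra
  then have "((1 + N) * N) * ((1 - q) * (P n 1 - P n 0)) = ((1 + N) * N) * (- eigval n * P n 0)"
    by (simp add: algebra_simps)
  moreover have nz: "(1 + N) * N \<noteq> 0" using N by simp
  ultimately show ?thesis by (simp only: mult_left_cancel[OF nz])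
qed

text \<open>Add the first structure relation at \<open>k + 1\<close> and the second at
  \<open>k\<close>: the terms with \<open>P (n - 1)\<close> cancel.\<close>

lemma P_difference_Suc:
  "(1 - q * q ^ Suc k) * (P n (Suc (Suc k)) - P n (Suc k)) - (1 - q * q ^ k) * (P n (Suc k) - P n k)
   = - eigval n * q ^ Suc k * P n (Suc k)"
proof (cases n)
  case 0
  then show ?thesis by (simp add: eigval_def)
next
  case (Suc m)
  define N where "N = q ^ n"
  have N: "N > 0" "1 + N > 0"
    using q_power_pos[of n] by (auto simp: N_def intro: add_pos_pos)
  have l: "N * eigval n = (1 - N) * (1 - q * N)"
    using N unfolding eigval_def N_def by simp
  have "((1 + N) * N) * ((1 - q * q ^ Suc k) * (P n (Suc (Suc k)) - P n (Suc k)) - (1 - q * q ^ k) * (P n (Suc k) - P n k))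
     = (1 + N) * N * (1 - q * q ^ Suc k) * (P n (Suc (Suc k)) - P n (Suc k)) + (1 + N) * N * (1 - q * q ^ k) * (P n k - P n (Suc k))"
    by algebra
  also have "\<dots> = (1 + N) * (- (N * eigval n) * q ^ Suc k * P n (Suc k))"
    unfolding l unfolding N_def Suc
      structure_relations[of m "Suc k", THEN conjunct1] structure_relations[of m k, THEN conjunct2]
    unfolding power_Suc[of q k] by algebra
  finally have "((1 + N) * N) * ((1 - q * q ^ Suc k) * (P n (Suc (Suc k)) - P n (Suc k)) - (1 - q * q ^ k) * (P n (Suc k) - P n k))
     = ((1 + N) * N) * (- eigval n * q ^ Suc k * P n (Suc k))"
    by (simp only: mult_minus_left mult_minus_right ac_simps)
  moreover have nz: "(1 + N) * N \<noteq> 0" using N by simp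
  ultimately show ?thesis by (simp only: mult_left_cancel[OF nz])
qed

subsection \<open>Orthogonality and linearization\<close>

lemma poly_nodes_tendsto: "(\<lambda>k. poly p (1 - q ^ k)) \<longlonglongrightarrow> poly p 1"
proof -
  have "(\<lambda>k. 1 - q ^ k) \<longlonglongrightarrow> 1 - 0"
    using q_pos q_less_1 by (intro tendsto_diff tendsto_const LIMSEQ_realpow_zero) auto
  then show ?thesis
    by (intro isCont_tendsto_compose[OF poly_isCont]) simp
qed

lemma poly_nodes_bounded:
  fixes p :: "real poly"
  obtains B where "B > 0" "\<And>k. \<bar>poly p (1 - q ^ k)\<bar> \<le> B"
proof -
  have "Bseq (\<lambda>k. poly p (1 - q ^ k))"
    using poly_nodes_tendsto convergentI convergent_imp_Bseq by blast
  then obtain B where B: "B > 0" "\<forall>k. norm (poly p (1 - q ^ k)) \<le> B" by (rule BseqE)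
  show ?thesis using B by (intro that[of B]) simp_all
qed

lemma summable_power_q: "summable (\<lambda>k. q ^ k)"
  using q_pos q_less_1 by (intro summable_geometric) simp

text \<open>Up to the factor \<open>1 - q\<close>, the Jackson \<open>q\<close>-integral over [0, 1]
  of the function sending t to p(1 - t).\<close>

definition L :: "real poly \<Rightarrow> real" where
  "L p = (\<Sum>k. q ^ k * poly p (1 - q ^ k))"

lemma summable_L: "summable (\<lambda>k. q ^ k * poly p (1 - q ^ k))"
proof -
  obtain B where B: "B > 0" "\<And>k. \<bar>poly p (1 - q ^ k)\<bar> \<le> B" using poly_nodes_bounded[of p] by metis
  show ?thesis
  proof (rule summable_comparison_test')
    show "summable (\<lambda>k. B * q ^ k)" by (intro summable_mult summable_power_q)
    show "norm (q ^ k * poly p (1 - q ^ k)) \<le> B * q ^ k" if "k \<ge> 0" for k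
      using B(2)[of k] q_power_pos[of k] by (simp add: abs_mult mult.commute)
  qed
qed

lemma L_add: "L (p + r) = L p + L r"
  unfolding L_def by (simp add: distrib_left suminf_add[OF summable_L summable_L])

lemma L_smult: "L (smult c p) = c * L p"
  unfolding L_def by (subst suminf_mult[OF summable_L, symmetric]) (simp add: mult.left_commute)

lemma L_0 [simp]: "L 0 = 0"
  by (simp add: L_def)

lemma L_sum: "L (\<Sum>i\<in>S. f i) = (\<Sum>i\<in>S. L (f i))"
  by (induction S rule: infinite_finite_induct) (simp_all add: L_add)

lemma eigval_eq: "eigval n = 1 / q ^ n + q * q ^ n - 1 - q"
  using q_power_pos[of n] by (simp add: eigval_def field_simps)

text \<open>The difference of the eigenvalues is a positive multiple of
  \<open>(q ^ n - q ^ m) * (1 - q ^ (m + n + 1))\<close>.\<close>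

lemma eigval_neq:
  assumes "m \<noteq> n"
  shows "eigval m \<noteq> eigval n"
proof
  assume "eigval m = eigval n"
  then have "(q ^ n - q ^ m) * (1 - q * q ^ (m + n)) = 0"
    using q_power_pos[of m] q_power_pos[of n]
    by (simp add: eigval_eq field_simps power_add)
  moreover have "q ^ n \<noteq> q ^ m"
    using assms q_pos q_less_1 by (metis less_irrefl linorder_neqE_nat power_strict_decreasing)
  ultimately show False
    using q_power_Suc_less_1[of "m + n"] by simp
qed

text \<open>Green's formula: multiplying the equation for \<open>n\<close> by \<open>P m\<close>,
  the one for \<open>m\<close> by \<open>P n\<close>, and subtracting makes the sum
  telescope.\<close>

lemma Casorati_sum:
  "(\<Sum>k\<le>K. (eigval m - eigval n) * (q ^ k * (P m k * P n k))) =
    (1 - q * q ^ K) * (P n (Suc K) * P m K - P n K * P m (Suc K))"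
proof (induction K)
  case 0
  have "(1 - q) * (P n 1 * P m 0 - P n 0 * P m 1)
     = ((1 - q) * (P n 1 - P n 0)) * P m 0 - ((1 - q) * (P m 1 - P m 0)) * P n 0"
    by algebra
  then show ?case
    unfolding P_difference_0 by (simp add: algebra_simps)
next
  case (Suc K)
  have "(1 - q * q ^ Suc K) * (P n (Suc (Suc K)) * P m (Suc K) - P n (Suc K) * P m (Suc (Suc K)))
       - (1 - q * q ^ K) * (P n (Suc K) * P m K - P n K * P m (Suc K))
     = ((1 - q * q ^ Suc K) * (P n (Suc (Suc K)) - P n (Suc K)) - (1 - q * q ^ K) * (P n (Suc K) - P n K)) * P m (Suc K)
       - ((1 - q * q ^ Suc K) * (P m (Suc (Suc K)) - P m (Suc K)) - (1 - q * q ^ K) * (P m (Suc K) - P m K)) * P n (Suc K)"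
    by algebra
  also have "\<dots> = (eigval m - eigval n) * (q ^ Suc K * (P m (Suc K) * P n (Suc K)))"
    unfolding P_difference_Suc by algebra
  finally show ?case
    unfolding sum.atMost_Suc Suc by linarith
qed

lemma P_tendsto: "(\<lambda>k. P n k) \<longlonglongrightarrow> poly (R n) 1"
  unfolding P_def by (rule poly_nodes_tendsto)

lemma L_R_mult_R_eq: "L (R m * R n) = (\<Sum>k. q ^ k * (P m k * P n k))"
  by (simp add: L_def P_def)

lemma L_orthogonal:
  assumes "m \<noteq> n"
  shows "L (R m * R n) = 0"
proof -
  \<comment> \<open>The Casoratian tends to 0 because both solutions converge as the nodes approach
    1.\<close>
  have "(\<lambda>K. (1 - q * q ^ K) * (P n (Suc K) * P m K - P n K * P m (Suc K)))
      \<longlonglongrightarrow> (1 - q * 0) * (poly (R n) 1 * poly (R m) 1 - poly (R n) 1 * poly (R m) 1)"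
    using q_pos q_less_1
    by (intro tendsto_mult tendsto_diff tendsto_const LIMSEQ_realpow_zero P_tendsto LIMSEQ_Suc[OF P_tendsto]) auto
  then have "(\<lambda>k. (eigval m - eigval n) * (q ^ k * (P m k * P n k))) sums 0"
    unfolding sums_def_le Casorati_sum by simp
  moreover have "(\<lambda>k. (eigval m - eigval n) * (q ^ k * (P m k * P n k))) sums ((eigval m - eigval n) * L (R m * R n))"
    unfolding L_R_mult_R_eq using summable_L[of "R m * R n"]
    by (intro sums_mult summable_sums) (simp add: P_def)
  ultimately have "(eigval m - eigval n) * L (R m * R n) = 0"
    using sums_unique2 by blast
  then show ?thesis using eigval_neq[OF assms] by simp
qed

text \<open>Expanding \<open>R (Suc 0) * R n * R (Suc n)\<close> in two ways gives
  \<open>A n * L (R (Suc n) * R (Suc n)) = C (Suc n) * L (R n * R n)\<close>; by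
  \<open>h_C_Suc\<close>, \<open>h n * L (R n * R n)\<close> is then constant.\<close>

lemma L_norm: "L (R n * R n) = 1 / ((1 - q) * h n)"
proof -
  have "h n * L (R n * R n) = 1 / (1 - q)"
  proof (induction n)
    case 0
    show ?case using q_pos q_less_1 by (simp add: h_0 L_def suminf_geometric)
  next
    case (Suc n)
    have "R (Suc 0) * R n * R (Suc n) = smult (A n) (R (Suc n) * R (Suc n))
        + smult (1 - A n - C n) (R n * R (Suc n)) + smult (C n) (R (n - 1) * R (Suc n))"
      unfolding R_Suc_0_mult by (simp add: algebra_simps del: qLeg.simps)
    then have 1: "L (R (Suc 0) * R n * R (Suc n)) = A n * L (R (Suc n) * R (Suc n))"
      by (simp add: L_add L_smult L_orthogonal del: qLeg.simps)
    have "R (Suc 0) * R n * R (Suc n) = R n * (R (Suc 0) * R (Suc n))"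
      by (simp only: ac_simps)
    also have "\<dots> = smult (A (Suc n)) (R n * R (Suc (Suc n)))
        + smult (1 - A (Suc n) - C (Suc n)) (R n * R (Suc n)) + smult (C (Suc n)) (R n * R n)"
      unfolding R_Suc_0_mult by (simp add: algebra_simps del: qLeg.simps)
    finally have "L (R (Suc 0) * R n * R (Suc n)) = C (Suc n) * L (R n * R n)"
      by (simp add: L_add L_smult L_orthogonal del: qLeg.simps)
    with 1 have "h (Suc n) * (A n * L (R (Suc n) * R (Suc n))) = (h (Suc n) * C (Suc n)) * L (R n * R n)"
      by (simp only: mult.assoc)
    also have "\<dots> = A n * (1 / (1 - q))"
      unfolding h_C_Suc Suc[symmetric] by (simp only: ac_simps)
    finally have "A n * (h (Suc n) * L (R (Suc n) * R (Suc n))) = A n * (1 / (1 - q))"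
      by (simp only: ac_simps)
    moreover have nz: "A n \<noteq> 0" using A_pos[of n] by simp
    ultimately show ?case by (simp only: mult_left_cancel[OF nz])
  qed
  then show ?thesis using h_pos[of n] q_less_1 by (simp add: field_simps)
qed

lemma L_R_mult_R: "L (R m * R n) = (if m = n then 1 / ((1 - q) * h n) else 0)"
  by (simp add: L_norm L_orthogonal)

section \<open>Fourier expansion, linearization coefficients and translations\<close>

lemma expansion_exists:
  assumes "degree p \<le> N"
  shows "\<exists>c. p = (\<Sum>k\<le>N. smult (c k) (R k))"
  using assms
proof (induction N arbitrary: p)
  case 0
  then have "p = smult (coeff p 0) (R 0)" by (auto elim: degree_eq_zeroE)
  then show ?case by (auto intro: exI[of _ "\<lambda>_. coeff p 0"])
next
  case (Suc N)
  have nz: "coeff (R (Suc N)) (Suc N) \<noteq> 0"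
    using degree_R[of "Suc N"] by (metis Zero_not_Suc degree_0 leading_coeff_0_iff)
  define a where "a = coeff p (Suc N) / coeff (R (Suc N)) (Suc N)"
  have "degree (p - smult a (R (Suc N))) \<le> N"
  proof (rule degree_le, intro allI impI)
    fix i assume i: "N < i"
    show "coeff (p - smult a (R (Suc N))) i = 0"
    proof (cases "i = Suc N")
      case True
      then show ?thesis using nz by (simp add: a_def del: qLeg.simps)
    next
      case False
      then have "coeff p i = 0" "coeff (R (Suc N)) i = 0"
        using i Suc.prems degree_R[of "Suc N"] by (auto intro!: coeff_eq_0 simp del: qLeg.simps)
      then show ?thesis by (simp del: qLeg.simps)
    qed
  qed
  from Suc.IH[OF this] obtain c where c: "p - smult a (R (Suc N)) = (\<Sum>k\<le>N. smult (c k) (R k))" by blast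
  have "p = (\<Sum>k\<le>Suc N. smult ((c(Suc N := a)) k) (R k))"
    using c by (simp add: algebra_simps del: qLeg.simps)
  then show ?case by blast
qed

text \<open>The Fourier coefficient for \<open>L\<close>; the factor in front is the reciprocal of
  \<open>L (R j * R j)\<close>.\<close>

definition coef :: "real poly \<Rightarrow> nat \<Rightarrow> real" where
  "coef p j = (1 - q) * h j * L (p * R j)"

lemma coef_sum: "coef (\<Sum>k\<le>N. smult (c k) (R k)) j = (if j \<le> N then c j else 0)"
proof -
  have "L ((\<Sum>k\<le>N. smult (c k) (R k)) * R j) = (\<Sum>k\<le>N. if k = j then c j / ((1 - q) * h j) else 0)"
    by (simp add: sum_distrib_right L_sum L_smult L_R_mult_R if_distrib[of "\<lambda>x. _ * x"] cong: if_cong)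
  also have "\<dots> = (if j \<le> N then c j / ((1 - q) * h j) else 0)"
    by simp
  finally show ?thesis using h_pos[of j] q_less_1 by (simp add: coef_def)
qed

lemma coef_add: "coef (p + r) j = coef p j + coef r j"
  by (simp add: coef_def algebra_simps L_add)

lemma coef_smult: "coef (smult c p) j = c * coef p j"
  by (simp add: coef_def L_smult)

lemma coef_R: "coef (R n) j = (if j = n then 1 else 0)"
  using h_pos[of n] q_less_1 by (simp add: coef_def L_R_mult_R)

lemma expansion:
  assumes "degree p \<le> N"
  shows "p = (\<Sum>k\<le>N. smult (coef p k) (R k))"
proof -
  obtain c where c: "p = (\<Sum>k\<le>N. smult (c k) (R k))" using expansion_exists[OF assms] by blast
  have "coef p k = c k" if "k \<le> N" for k using that c coef_sum by simp
  with c show ?thesis by simp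
qed

lemma coef_eq_0:
  assumes "degree p < j"
  shows "coef p j = 0"
  using coef_sum[of "coef p" "degree p" j] expansion[of p "degree p"] assms by simp

lemma degree_R_mult_R: "degree (R m * R n) = m + n"
  by (metis degree_R degree_mult_eq degree_0 mult_eq_0_iff add_0 add_0_right qLeg.simps(1) zero_neq_one)

text \<open>Existence is the Fourier expansion and uniqueness is orthogonality; the support
  condition fixes the values beyond \<open>m + n\<close>.\<close>

lemma lin_coeff_eq: "lin_coeff q m n = coef (R m * R n)"
  unfolding lin_coeff_def
proof (rule the_equality)
  show "(\<forall>k. coef (R m * R n) k \<noteq> 0 \<longrightarrow> k \<le> m + n) \<and>
      R m * R n = (\<Sum>k\<le>m + n. smult (coef (R m * R n) k) (R k))"
    using coef_eq_0[of "R m * R n"] expansion[of "R m * R n" "m + n"] degree_R_mult_R[of m n]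
    by (metis le_refl not_le)
next
  fix c assume c: "(\<forall>k. c k \<noteq> 0 \<longrightarrow> k \<le> m + n) \<and> R m * R n = (\<Sum>k\<le>m + n. smult (c k) (R k))"
  show "c = coef (R m * R n)"
    using c coef_sum[of c "m + n"] by fastforce
qed

text \<open>\<open>L (R m * R n * R j)\<close> is symmetric in its indices, and
  \<open>R m * R j\<close> has degree below \<open>n\<close>, hence is orthogonal to
  \<open>R n\<close>. This justifies the lower summation limit in \<open>transl\<close>.\<close>

lemma coef_R_mult_R_eq_0:
  assumes "m + j < n"
  shows "coef (R m * R n) j = 0"
proof -
  have "R m * R n * R j = (R m * R j) * R n" by (simp only: ac_simps)
  also have "R m * R j = (\<Sum>k\<le>m + j. smult (coef (R m * R j) k) (R k))"
    by (rule expansion) (simp add: degree_R_mult_R)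
  also have "L (\<dots> * R n) = (\<Sum>k\<le>m + j. coef (R m * R j) k * L (R k * R n))"
    by (simp add: sum_distrib_right L_sum L_smult)
  also have "\<dots> = 0"
    using assms by (intro sum.neutral) (auto simp: L_orthogonal)
  finally show ?thesis by (simp add: coef_def)
qed

text \<open>The linear functional on polynomials taking \<open>R k\<close> to
  \<open>\<phi> k\<close>. Translations are its values on products, so their identities reduce to
  identities between polynomials.\<close>

definition lin_ext :: "(nat \<Rightarrow> complex) \<Rightarrow> real poly \<Rightarrow> complex" where
  "lin_ext \<phi> p = (\<Sum>k\<le>degree p. of_real (coef p k) * \<phi> k)"

lemma lin_ext_eq:
  assumes "degree p \<le> N"
  shows "lin_ext \<phi> p = (\<Sum>k\<le>N. of_real (coef p k) * \<phi> k)"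
  unfolding lin_ext_def using assms coef_eq_0[of p]
  by (intro sum.mono_neutral_left) auto

lemma lin_ext_add: "lin_ext \<phi> (p + r) = lin_ext \<phi> p + lin_ext \<phi> r"
proof -
  define N where "N = max (degree p) (degree r)"
  have "degree p \<le> N" "degree r \<le> N" "degree (p + r) \<le> N"
    by (auto simp: N_def intro: degree_add_le)
  then show ?thesis
    by (simp add: lin_ext_eq[of _ N] coef_add sum.distrib distrib_right)
qed

lemma lin_ext_smult: "lin_ext \<phi> (smult c p) = of_real c * lin_ext \<phi> p"
  by (simp add: lin_ext_eq[of _ "degree p", OF degree_smult_le] lin_ext_def coef_smult sum_distrib_left mult.assoc)

lemma lin_ext_0 [simp]: "lin_ext \<phi> 0 = 0"
  using lin_ext_smult[of \<phi> 0 0] by simp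

lemma lin_ext_sum: "lin_ext \<phi> (\<Sum>i\<in>S. f i) = (\<Sum>i\<in>S. lin_ext \<phi> (f i))"
  by (induction S rule: infinite_finite_induct) (simp_all add: lin_ext_add)

lemma lin_ext_R: "lin_ext \<phi> (R n) = \<phi> n"
  by (simp add: lin_ext_def coef_R degree_R if_distrib[of "\<lambda>x. of_real x * _"] cong: if_cong)

lemma transl_eq: "transl q n \<phi> m = lin_ext \<phi> (R m * R n)"
proof -
  have "lin_ext \<phi> (R m * R n) = (\<Sum>k\<le>m + n. of_real (coef (R m * R n) k) * \<phi> k)"
    by (simp add: lin_ext_eq degree_R_mult_R)
  also have "\<dots> = (\<Sum>k\<in>{(if m \<le> n then n - m else m - n)..m + n}. of_real (coef (R m * R n) k) * \<phi> k)"
  proof (intro sum.mono_neutral_right ballI)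
    fix k assume "k \<in> {..m + n} - {(if m \<le> n then n - m else m - n)..m + n}"
    then have "m + k < n \<or> n + k < m" by (auto split: if_splits)
    then have "coef (R m * R n) k = 0"
      using coef_R_mult_R_eq_0[of m k n] coef_R_mult_R_eq_0[of n k m] by (auto simp: mult.commute)
    then show "of_real (coef (R m * R n) k) * \<phi> k = 0" by simp
  qed auto
  finally show ?thesis by (simp add: transl_def lin_coeff_eq)
qed

text \<open>For this sequence the functional is evaluation at a node, hence multiplicative; the
  product formula \<open>transl_e\<close> comes from it.\<close>

lemma lin_ext_P: "lin_ext (\<lambda>n. of_real (P n k)) p = of_real (poly p (1 - q ^ k))"
  by (subst (2) expansion[OF order_refl]) (simp add: lin_ext_def P_def poly_sum)

lemma lin_ext_transl: "lin_ext (transl q n \<phi>) p = lin_ext \<phi> (R n * p)"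
proof -
  have "lin_ext \<phi> (R n * p) = lin_ext \<phi> (\<Sum>k\<le>degree p. smult (coef p k) (R k * R n))"
    by (subst (1) expansion[OF order_refl, of p]) (simp add: sum_distrib_left mult.commute)
  then show ?thesis
    by (simp add: lin_ext_sum lin_ext_smult transl_eq lin_ext_def[of "transl q n \<phi>"])
qed

subsection \<open>Decay of the characters and their pairings\<close>

lemma sqrt_q: "0 < sqrt q" "sqrt q < 1" "sqrt q * sqrt q = q" "sqrt q ^ (2 * n) = q ^ n"
  using q_pos q_less_1 by (simp_all add: power_mult)

text \<open>One term of the nonnegative series \<open>L (R n * R n)\<close> is at most its sum,
  which is of order \<open>q ^ n\<close>; taking roots brings in \<open>sqrt q\<close>.\<close>

lemma P_bound: "\<bar>P n k\<bar> \<le> sqrt (1 / (1 - q)) * (sqrt q ^ n / sqrt q ^ k)"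
proof -
  have sq: "sqrt q ^ n * sqrt q ^ n = q ^ n" for n
    using q_pos by (simp flip: power_mult_distrib)
  have "q ^ k * (P n k * P n k) \<le> L (R n * R n)"
    unfolding L_R_mult_R_eq
    using sum_le_suminf[of "\<lambda>k. q ^ k * (P n k * P n k)" "{k}"] summable_L[of "R n * R n"] q_pos
    by (simp add: P_def)
  also have "\<dots> = q ^ n / (1 - q * (q ^ n)\<^sup>2)"
    using q_less_1 h_denominator_pos[of n] by (simp add: L_norm h_eq)
  also have "\<dots> \<le> q ^ n / (1 - q)"
    using q_less_1 q_pos one_minus_q_le[of n] by (intro divide_left_mono mult_pos_pos h_denominator_pos) auto
  finally have "P n k * P n k \<le> q ^ n / (1 - q) / q ^ k"
    using q_power_pos[of k] by (subst pos_le_divide_eq) (simp_all add: mult.commute)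
  then have "(P n k)\<^sup>2 \<le> 1 / (1 - q) * (q ^ n / q ^ k)"
    by (simp add: power2_eq_square)
  also have "\<dots> = (sqrt (1 / (1 - q)) * (sqrt q ^ n / sqrt q ^ k))\<^sup>2"
    using q_less_1 by (simp add: power_mult_distrib power_divide power2_eq_square[of "sqrt q ^ _"] sq)
  finally show ?thesis
    using sqrt_q q_less_1 by (intro abs_le_square_iff[THEN iffD2, THEN order_trans[OF _ eq_refl[OF abs_of_nonneg]]]) auto
qed

text \<open>The recurrence in n, read as a formula for \<open>q\<^sup>k P n k\<close>, gains a factor \<open>q\<^sup>n / q\<^sup>k\<close>
  over the bound coming from the norm of \<open>R n\<close>; this makes \<open>h n * P n k\<close> summable over n.\<close>
lemma P_bound_improved:
  obtains K where "K > 0" "\<And>n k. h n * \<bar>P n k\<bar> \<le> K * (sqrt q ^ n / sqrt q ^ (3 * k))"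
proof -
  define s where "s = sqrt q"
  define c where "c = sqrt (1 / (1 - q))"
  \<comment> \<open>\<open>8 / (1 - q)\<close> collects two coefficients of size
    \<open>2 / (1 - q) * q ^ Suc m\<close>, each times a difference of size \<open>2 * b\<close>;
    \<open>1 / s\<close> raises the exponent \<open>m\<close> in \<open>b\<close> to
    \<open>Suc m\<close>.\<close>
  define M where "M = 8 * c / ((1 - q) * s)"
  have s: "0 < s" "s < 1" and qs: "q ^ n = s ^ (2 * n)" for n
    using sqrt_q by (simp_all add: s_def)
  have c: "0 \<le> c" using q_less_1 by (simp add: c_def)
  have M: "0 \<le> M" using c s q_less_1 by (simp add: M_def)
  have step: "\<bar>P (Suc m) k\<bar> \<le> M * (s ^ (3 * Suc m) / s ^ (3 * k))" for m k
  proof -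
    define b where "b = c * (s ^ m / s ^ k)"
    have b: "\<bar>P i k\<bar> \<le> b" if "i \<ge> m" for i
    proof -
      have "\<bar>P i k\<bar> \<le> c * (s ^ i / s ^ k)" using P_bound by (simp add: c_def s_def)
      also have "\<dots> \<le> b" unfolding b_def using that s c
        by (intro mult_left_mono divide_right_mono power_decreasing) auto
      finally show ?thesis .
    qed
    have "(1 + q) * q ^ k * P (Suc m) k
        = A (Suc m) * (P (Suc m) k - P (Suc (Suc m)) k) + C (Suc m) * (P (Suc m) k - P m k)"
      using P_recurrence[of k "Suc m"] unfolding P_1 diff_Suc_1 by (simp add: algebra_simps)
    then have "(1 + q) * q ^ k * \<bar>P (Suc m) k\<bar>
        = \<bar>A (Suc m) * (P (Suc m) k - P (Suc (Suc m)) k) + C (Suc m) * (P (Suc m) k - P m k)\<bar>"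
      using q_pos q_power_pos[of k] by (metis abs_mult abs_of_pos add_pos_pos mult_pos_pos zero_less_one)
    also have "\<dots> \<le> A (Suc m) * (2 * b) + C (Suc m) * (2 * b)"
      using b[of m] b[of "Suc m"] b[of "Suc (Suc m)"] A_pos[of "Suc m"] C_nonneg[of "Suc m"]
      by (intro abs_triangle_ineq[THEN order_trans] add_mono) (simp_all add: abs_mult mult_left_mono)
    also have "\<dots> \<le> (2 / (1 - q) * q ^ Suc m) * (2 * b) + (2 / (1 - q) * q ^ Suc m) * (2 * b)"
      using b[of m] by (intro add_mono mult_right_mono A_le C_le) auto
    also have "\<dots> = 8 / (1 - q) * (q ^ Suc m * b)" by simp
    finally have "(1 + q) * q ^ k * \<bar>P (Suc m) k\<bar> \<le> 8 / (1 - q) * (q ^ Suc m * b)" .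
    moreover have "1 * q ^ k * \<bar>P (Suc m) k\<bar> \<le> (1 + q) * q ^ k * \<bar>P (Suc m) k\<bar>"
      using q_pos by (intro mult_right_mono) auto
    ultimately have "q ^ k * \<bar>P (Suc m) k\<bar> \<le> 8 / (1 - q) * (q ^ Suc m * b)" by linarith
    then have "\<bar>P (Suc m) k\<bar> \<le> 8 / (1 - q) * (q ^ Suc m * b) / q ^ k"
      using q_power_pos[of k] by (subst pos_le_divide_eq) (simp_all add: mult.commute)
    also have "8 / (1 - q) * (q ^ Suc m * b) / q ^ k = M * ((q ^ Suc m * s ^ Suc m) / (q ^ k * s ^ k))"
      using s q_less_1 by (simp add: M_def b_def ac_simps)
    also have "q ^ Suc m * s ^ Suc m = s ^ (3 * Suc m)"
      unfolding qs power_add[symmetric] by (rule arg_cong[of _ _ "\<lambda>i. s ^ i"]) simp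
    also have "q ^ k * s ^ k = s ^ (3 * k)"
      unfolding qs power_add[symmetric] by (rule arg_cong[of _ _ "\<lambda>i. s ^ i"]) simp
    finally show ?thesis .
  qed
  \<comment> \<open>Passing from \<open>M\<close> to \<open>1 + M\<close> covers
    \<open>n = 0\<close>, where \<open>P 0 k = 1\<close>.\<close>
  have bound: "\<bar>P n k\<bar> \<le> (1 + M) * (s ^ (3 * n) / s ^ (3 * k))" for n k
  proof (cases n)
    case 0
    have "1 * 1 \<le> (1 + M) * (1 / s ^ (3 * k))"
      using s M by (intro mult_mono) (auto simp: power_le_one)
    then show ?thesis by (simp add: 0)
  next
    case (Suc m)
    have "M * (s ^ (3 * Suc m) / s ^ (3 * k)) \<le> (1 + M) * (s ^ (3 * Suc m) / s ^ (3 * k))"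
      using s by (intro mult_right_mono) auto
    then show ?thesis using step[of m k] unfolding Suc by linarith
  qed
  show ?thesis
  proof (rule that[of "(1 + M) / (1 - q)"])
    show "(1 + M) / (1 - q) > 0" using M q_less_1 by simp
    fix n k
    \<comment> \<open>The growth of \<open>h n\<close> consumes \<open>s ^ (2 * n)\<close>, so a
      geometric factor \<open>s ^ n\<close> survives.\<close>
    have "h n * \<bar>P n k\<bar> \<le> 1 / ((1 - q) * q ^ n) * ((1 + M) * (s ^ (3 * n) / s ^ (3 * k)))"
      using h_le[of n] h_pos[of n] q_less_1 q_power_pos[of n] by (intro mult_mono bound) auto
    also have "s ^ (3 * n) = q ^ n * s ^ n"
      unfolding qs power_add[symmetric] by (rule arg_cong[of _ _ "\<lambda>i. s ^ i"]) simp
    also have "1 / ((1 - q) * q ^ n) * ((1 + M) * (q ^ n * s ^ n / s ^ (3 * k))) = (1 + M) / (1 - q) * (s ^ n / s ^ (3 * k))"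
      using q_power_pos[of n] by simp
    finally show "h n * \<bar>P n k\<bar> \<le> (1 + M) / (1 - q) * (sqrt q ^ n / sqrt q ^ (3 * k))"
      by (simp only: s_def)
  qed
qed

lemma summable_sqrt_q: "summable (\<lambda>n. sqrt q ^ n)"
  using sqrt_q by (intro summable_geometric) simp

definition e :: "nat \<Rightarrow> nat \<Rightarrow> complex" where
  "e k n = of_real (P n k)"

lemma l1hI:
  assumes "\<And>n. h n * norm (f n) \<le> t n" "summable t"
  shows "f \<in> l1h q" and "l1h_norm q f \<le> suminf t"
proof -
  have le: "norm (f n) * h n \<le> t n" for n using assms(1)[of n] by (simp add: mult.commute)
  have s: "summable (\<lambda>n. norm (f n) * h n)"
    using assms(2) by (rule summable_comparison_test') (use le h_pos in \<open>auto simp: abs_mult less_imp_le\<close>)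
  then show "f \<in> l1h q" by (simp add: l1h_def)
  show "l1h_norm q f \<le> suminf t" unfolding l1h_norm_def by (rule suminf_le[OF le s assms(2)])
qed

lemma e_in_l1h: "e k \<in> l1h q"
proof -
  obtain K where K: "K > 0" "\<And>n k. h n * \<bar>P n k\<bar> \<le> K * (sqrt q ^ n / sqrt q ^ (3 * k))"
    using P_bound_improved by metis
  show ?thesis
  proof (rule l1hI(1))
    show "h n * norm (e k n) \<le> K / sqrt q ^ (3 * k) * sqrt q ^ n" for n
      using K(2)[of n k] by (simp add: e_def)
  qed (intro summable_mult summable_sqrt_q)
qed

lemma linftyE:
  assumes "\<phi> \<in> linfty"
  obtains B where "B > 0" "\<And>n. norm (\<phi> n) \<le> B"
  using assms by (auto simp: linfty_def bounded_pos)

definition pairing :: "(nat \<Rightarrow> complex) \<Rightarrow> (nat \<Rightarrow> complex) \<Rightarrow> complex" where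
  "pairing \<phi> f = (\<Sum>m. \<phi> m * f m * of_real (h m))"

lemma summable_pairing:
  assumes "\<phi> \<in> linfty" "f \<in> l1h q"
  shows "summable (\<lambda>m. \<phi> m * f m * of_real (h m))"
proof -
  obtain B where B: "B > 0" "\<And>n. norm (\<phi> n) \<le> B" using linftyE[OF assms(1)] by metis
  have "summable (\<lambda>m. B * (norm (f m) * h m))"
    using assms(2) by (intro summable_mult) (simp add: l1h_def)
  then show ?thesis
  proof (rule summable_comparison_test')
    show "norm (\<phi> m * f m * of_real (h m)) \<le> B * (norm (f m) * h m)" for m
      using B(2)[of m] h_pos[of m] by (simp add: norm_mult mult.assoc mult_right_mono)
  qed
qed

lemma pairing_sums:
  assumes "\<phi> \<in> linfty" "f \<in> l1h q"
  shows "(\<lambda>m. \<phi> m * f m * of_real (h m)) sums pairing \<phi> f"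
  unfolding pairing_def using summable_pairing[OF assms] by (rule summable_sums)

section \<open>Translations paired with the characters\<close>

lemma transl_1:
  "transl q (Suc 0) \<phi> m = of_real (A m) * \<phi> (Suc m) + of_real (1 - A m - C m) * \<phi> m + of_real (C m) * \<phi> (m - 1)"
  unfolding transl_eq mult.commute[of "R m"] R_Suc_0_mult
  by (simp add: lin_ext_add lin_ext_smult lin_ext_R del: qLeg.simps)

lemma transl_0: "transl q 0 \<phi> = \<phi>"
  by (rule ext) (simp add: transl_eq lin_ext_R)

text \<open>Translations inherit the recurrence of the polynomials, so all of them are reached from
  \<open>transl q (Suc 0)\<close>.\<close>

lemma transl_recurrence:
  "transl q n (transl q (Suc 0) \<phi>) m =
     of_real (A n) * transl q (Suc n) \<phi> m + of_real (1 - A n - C n) * transl q n \<phi> m + of_real (C n) * transl q (n - 1) \<phi> m"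
proof -
  have "transl q n (transl q (Suc 0) \<phi>) m = lin_ext \<phi> (R m * (R (Suc 0) * R n))"
    unfolding transl_eq[of n] lin_ext_transl by (simp only: ac_simps)
  then show ?thesis
    unfolding R_Suc_0_mult by (simp add: transl_eq distrib_left lin_ext_add lin_ext_smult del: qLeg.simps)
qed

lemma transl_1_in_linfty:
  assumes "\<phi> \<in> linfty"
  shows "transl q (Suc 0) \<phi> \<in> linfty"
proof -
  obtain B where B: "B > 0" "\<And>n. norm (\<phi> n) \<le> B" using linftyE[OF assms] by metis
  define c where "c = 2 / (1 - q)"
  have c: "0 \<le> c" using q_less_1 by (simp add: c_def)
  have b: "0 \<le> A m" "A m \<le> c" "0 \<le> C m" "C m \<le> c" for m
    using A_le[of m] C_le[of m] A_pos[of m] C_nonneg[of m] mult_left_mono[OF q_power_le_1[of m] c]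
    by (simp_all add: c_def)
  have AC: "norm (of_real (A m) :: complex) \<le> c" "norm (of_real (C m) :: complex) \<le> c"
    "norm (of_real (1 - A m - C m) :: complex) \<le> 1 + c + c" for m
    using b[of m] unfolding norm_of_real abs_le_iff by linarith+
  have "norm (transl q (Suc 0) \<phi> m) \<le> c * B + (1 + c + c) * B + c * B" for m
    unfolding transl_1
    by (intro norm_triangle_le add_mono norm_mult_ineq[THEN order_trans] mult_mono AC B(2)) (use c in auto)
  then show ?thesis unfolding linfty_def bounded_iff by blast
qed

lemma P_tendsto_0: "(\<lambda>n. P n k) \<longlonglongrightarrow> 0"
proof (rule tendsto_rabs_zero_cancel, rule tendsto_sandwich[of "\<lambda>_. 0"])
  show "\<forall>\<^sub>F n in sequentially. \<bar>P n k\<bar> \<le> sqrt (1 / (1 - q)) * (sqrt q ^ n / sqrt q ^ k)"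
    using P_bound by simp
  have "(\<lambda>n. sqrt (1 / (1 - q)) * (sqrt q ^ n / sqrt q ^ k)) \<longlonglongrightarrow> sqrt (1 / (1 - q)) * (0 / sqrt q ^ k)"
    using sqrt_q by (intro tendsto_intros LIMSEQ_realpow_zero) auto
  then show "(\<lambda>n. sqrt (1 / (1 - q)) * (sqrt q ^ n / sqrt q ^ k)) \<longlonglongrightarrow> 0" by simp
qed auto

text \<open>Summation by parts: by \<open>h_C_Suc\<close>, \<open>transl q (Suc 0)\<close> is
  symmetric for the weights \<open>h\<close>, and \<open>e k\<close> is its eigenvector, so only a
  boundary term survives.\<close>

lemma transl_1_sum:
  "(\<Sum>m\<le>M. (transl q (Suc 0) \<phi> m * e k m - \<phi> m * (of_real (P (Suc 0) k) * e k m)) * of_real (h m)) =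
    of_real (h M * A M) * (\<phi> (Suc M) * e k M - \<phi> M * e k (Suc M))"
proof -
  have eP: "of_real (P (Suc 0) k) * e k m =
      of_real (A m) * e k (Suc m) + of_real (1 - A m - C m) * e k m + of_real (C m) * e k (m - 1)" for m
    unfolding e_def of_real_mult[symmetric] P_recurrence by simp
  show ?thesis
  proof (induction M)
    case 0
    have single: "(\<Sum>m\<in>{0::nat}. f m) = f 0" for f :: "nat \<Rightarrow> complex" by simp
    show ?case
      unfolding atMost_0 single transl_1 eP C_0
      by (simp add: algebra_simps)
  next
    case (Suc M)
    have hC: "(of_real (h M * A M) :: complex) = of_real (h (Suc M)) * of_real (C (Suc M))"
      by (simp flip: h_C_Suc)
    show ?case unfolding sum.atMost_Suc Suc hC transl_1[of _ "Suc M"] eP[of "Suc M"] diff_Suc_1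
      by (simp add: algebra_simps)
  qed
qed

text \<open>The boundary term vanishes in the limit: \<open>h M * A M\<close> and
  \<open>\<phi>\<close> stay bounded while \<open>P M k\<close> tends to 0.\<close>

lemma pairing_transl_1:
  assumes "\<phi> \<in> linfty"
  shows "pairing (transl q (Suc 0) \<phi>) (e k) = of_real (P (Suc 0) k) * pairing \<phi> (e k)"
proof -
  obtain B where B: "B > 0" "\<And>n. norm (\<phi> n) \<le> B" using linftyE[OF assms] by metis
  have "(\<lambda>M. of_real (h M * A M) * (\<phi> (Suc M) * e k M - \<phi> M * e k (Suc M))) \<longlonglongrightarrow> 0"
  proof (rule Lim_null_comparison)
    show "\<forall>\<^sub>F M in sequentially. norm (of_real (h M * A M) * (\<phi> (Suc M) * e k M - \<phi> M * e k (Suc M)))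
        \<le> 2 / (1 - q) * (B * \<bar>P M k\<bar> + B * \<bar>P (Suc M) k\<bar>)"
    proof (intro always_eventually allI)
      fix M
      have "norm (\<phi> (Suc M) * e k M - \<phi> M * e k (Suc M)) \<le> B * \<bar>P M k\<bar> + B * \<bar>P (Suc M) k\<bar>"
        by (intro order_trans[OF norm_triangle_ineq4] add_mono) (simp_all add: norm_mult e_def B mult_right_mono)
      moreover have "norm (of_real (h M * A M) :: complex) \<le> 2 / (1 - q)"
        unfolding norm_of_real using h_A_le[of M] A_pos[of M] h_pos[of M] by simp
      ultimately show "norm (of_real (h M * A M) * (\<phi> (Suc M) * e k M - \<phi> M * e k (Suc M)))
        \<le> 2 / (1 - q) * (B * \<bar>P M k\<bar> + B * \<bar>P (Suc M) k\<bar>)"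
        unfolding norm_mult using q_less_1 by (intro mult_mono) auto
    qed
    have "(\<lambda>M. 2 / (1 - q) * (B * \<bar>P M k\<bar> + B * \<bar>P (Suc M) k\<bar>)) \<longlonglongrightarrow> 2 / (1 - q) * (B * \<bar>0\<bar> + B * \<bar>0\<bar>)"
      by (intro tendsto_mult tendsto_add tendsto_const tendsto_rabs P_tendsto_0 LIMSEQ_Suc[OF P_tendsto_0])
    then show "(\<lambda>M. 2 / (1 - q) * (B * \<bar>P M k\<bar> + B * \<bar>P (Suc M) k\<bar>)) \<longlonglongrightarrow> 0" by simp
  qed
  then have "(\<lambda>m. (transl q (Suc 0) \<phi> m * e k m - \<phi> m * (of_real (P (Suc 0) k) * e k m)) * of_real (h m)) sums 0"
    unfolding sums_def_le transl_1_sum .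
  moreover have "(\<lambda>m. transl q (Suc 0) \<phi> m * e k m * of_real (h m) - of_real (P (Suc 0) k) * (\<phi> m * e k m * of_real (h m)))
      sums (pairing (transl q (Suc 0) \<phi>) (e k) - of_real (P (Suc 0) k) * pairing \<phi> (e k))"
    by (intro sums_diff sums_mult pairing_sums transl_1_in_linfty assms e_in_l1h)
  ultimately show ?thesis
    using sums_unique2 by (fastforce simp: algebra_simps)
qed

text \<open>The induction keeps \<open>\<phi>\<close> general because its step also applies the
  hypothesis to \<open>transl q (Suc 0) \<phi>\<close>.\<close>

lemma transl_e_sums:
  assumes "\<phi> \<in> linfty"
  shows "(\<lambda>m. transl q n \<phi> m * e k m * of_real (h m)) sums (of_real (P n k) * pairing \<phi> (e k))"
  using assms
proof (induction n arbitrary: \<phi> rule: less_induct)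
  case (less n)
  show ?case
  proof (cases n)
    case 0
    then show ?thesis using pairing_sums[OF less.prems e_in_l1h] by (simp add: transl_0)
  next
    case (Suc m)
    define a where "a = (of_real (A m) :: complex)"
    define b where "b = (of_real (1 - A m - C m) :: complex)"
    define c where "c = (of_real (C m) :: complex)"
    have a: "a \<noteq> 0" using A_pos[of m] by (simp add: a_def)
    have T: "transl q (Suc m) \<phi> j = (transl q m (transl q (Suc 0) \<phi>) j - b * transl q m \<phi> j - c * transl q (m - 1) \<phi> j) / a" for j
      using a unfolding transl_recurrence by (simp add: a_def b_def c_def)
    have P: "(of_real (P (Suc m) k) :: complex) = (of_real (P (Suc 0) k) * of_real (P m k) - b * of_real (P m k) - c * of_real (P (m - 1) k)) / a"
      using a unfolding of_real_mult[symmetric] P_recurrence by (simp add: a_def b_def c_def)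
    have IH: "(\<lambda>j. transl q i \<psi> j * e k j * of_real (h j)) sums (of_real (P i k) * pairing \<psi> (e k))"
      if "i \<le> m" "\<psi> \<in> linfty" for i \<psi>
      using less.IH[of i \<psi>] that Suc by simp
    have "(\<lambda>j. (transl q m (transl q (Suc 0) \<phi>) j * e k j * of_real (h j) - b * (transl q m \<phi> j * e k j * of_real (h j))
          - c * (transl q (m - 1) \<phi> j * e k j * of_real (h j))) / a)
       sums ((of_real (P m k) * pairing (transl q (Suc 0) \<phi>) (e k) - b * (of_real (P m k) * pairing \<phi> (e k))
          - c * (of_real (P (m - 1) k) * pairing \<phi> (e k))) / a)"
      by (intro sums_divide sums_diff sums_mult IH transl_1_in_linfty less.prems) auto
    then show ?thesis
      unfolding Suc T P pairing_transl_1[OF less.prems] by (simp add: algebra_simps)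
  qed
qed

subsection \<open>Derivations\<close>

lemma transl_e: "transl q n (e k) m = of_real (P n k) * e k m"
  using lin_ext_P[of k "R m * R n"] unfolding transl_eq e_def[abs_def] by (simp add: P_def)

text \<open>\<open>conv\<close> translates its first argument. With \<open>e k\<close> there, the
  product formula acts termwise; with \<open>e k\<close> second, as in \<open>conv_e_right\<close>,
  the translation has to be moved across by \<open>transl_e_sums\<close>.\<close>

lemma conv_e_left:
  assumes "\<phi> \<in> linfty"
  shows "conv q (e k) \<phi> n = of_real (P n k) * pairing \<phi> (e k)"
  unfolding conv_def transl_e
  using sums_mult[OF pairing_sums[OF assms e_in_l1h[of k]], of "of_real (P n k)"]
  by (intro sums_unique[symmetric]) (simp add: ac_simps)

lemma conv_e_right:
  assumes "\<phi> \<in> linfty"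
  shows "conv q \<phi> (e k) n = of_real (P n k) * pairing \<phi> (e k)"
  unfolding conv_def using transl_e_sums[OF assms] by (rule sums_unique[symmetric])

lemma e_in_linfty: "e k \<in> linfty"
  unfolding linfty_def e_def[abs_def]
  by (simp add: convergent_imp_bounded[OF tendsto_of_real[OF P_tendsto_0]])

lemma pairing_e_e_nonzero: "pairing (e k) (e k) \<noteq> 0"
proof -
  define f where "f m = P m k * P m k * h m" for m
  have "(\<lambda>m. of_real (f m) :: complex) sums pairing (e k) (e k)"
    using pairing_sums[OF e_in_linfty e_in_l1h] by (simp add: f_def e_def)
  then have "summable f" and eq: "pairing (e k) (e k) = of_real (suminf f)"
    by (auto simp: sums_iff summable_of_real_iff suminf_of_real)
  have "0 \<le> f m" for m using h_pos[of m] by (simp add: f_def)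
  \<comment> \<open>The term at \<open>m = 0\<close> equals 1.\<close>
  then have "sum f {0} \<le> suminf f"
    using \<open>summable f\<close> by (intro sum_le_suminf) auto
  then have "0 < suminf f" by (simp add: f_def h_0)
  then show ?thesis by (simp add: eq)
qed

section \<open>The unit vectors and their expansion in the characters\<close>

definition \<epsilon> :: "nat \<Rightarrow> nat \<Rightarrow> complex" where
  "\<epsilon> n m = (if m = n then of_real (1 / h n) else 0)"

lemma \<epsilon>_in_l1h: "\<epsilon> n \<in> l1h q"
  by (rule l1hI(1)[OF order_refl], rule summable_finite[of "{n}"]) (auto simp: \<epsilon>_def)

text \<open>Translating \<open>\<epsilon> 0\<close> extracts the coefficient of \<open>R 0\<close>
  in \<open>R m * R n\<close>, which by orthogonality is \<open>1 / h n\<close> if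
  \<open>m = n\<close> and 0 otherwise.\<close>

lemma conv_\<epsilon>_0_left: "conv q (\<epsilon> 0) \<phi> n = \<phi> n"
proof -
  have "transl q n (\<epsilon> 0) m * \<phi> m * of_real (h m) = (if m = n then \<phi> n else 0)" for m
  proof -
    have "transl q n (\<epsilon> 0) m = of_real (coef (R m * R n) 0)"
      unfolding transl_eq lin_ext_def by (simp add: \<epsilon>_def h_0 sum.delta if_distrib cong: if_cong)
    also have "\<dots> = (if m = n then of_real (1 / h n) else 0)"
      using q_less_1 by (simp add: coef_def h_0 L_R_mult_R)
    finally show ?thesis using h_pos[of n] by simp
  qed
  then show ?thesis
    using sums_unique[OF sums_single[of n "\<lambda>_. \<phi> n"]] by (simp add: conv_def)
qed

lemma conv_\<epsilon>_0_right: "conv q \<phi> (\<epsilon> 0) n = \<phi> n"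
proof -
  have "transl q n \<phi> 0 = \<phi> n" by (simp add: transl_eq lin_ext_R)
  then show ?thesis
    unfolding conv_def by (subst suminf_finite[of "{0}"]) (auto simp: \<epsilon>_def h_0)
qed

text \<open>Orthogonality says \<open>(1 - q) * L (R n * R m) = \<epsilon> n m\<close>; written as a
  series over the nodes, with its case \<open>n = 0\<close> subtracted, it gives the
  expansion.\<close>

lemma \<epsilon>_expansion: "(\<lambda>k. of_real ((1 - q) * q ^ k * (P n k - 1)) * e k m) sums (\<epsilon> n m - \<epsilon> 0 m)"
proof -
  have "(\<lambda>k. (1 - q) * (q ^ k * poly (R n * R m) (1 - q ^ k) - q ^ k * poly (R 0 * R m) (1 - q ^ k)))
      sums ((1 - q) * (L (R n * R m) - L (R 0 * R m)))"
    unfolding L_def by (intro sums_mult sums_diff summable_sums summable_L)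
  then have "(\<lambda>k. (1 - q) * q ^ k * (P n k - 1) * P m k) sums ((1 - q) * (L (R n * R m) - L (R 0 * R m)))"
    by (simp add: P_def algebra_simps)
  then have "(\<lambda>k. of_real ((1 - q) * q ^ k * (P n k - 1) * P m k) :: complex)
      sums of_real ((1 - q) * (L (R n * R m) - L (R 0 * R m)))"
    by (rule sums_of_real)
  moreover have "(of_real ((1 - q) * (L (R n * R m) - L (R 0 * R m))) :: complex) = \<epsilon> n m - \<epsilon> 0 m"
    using q_less_1 unfolding L_R_mult_R by (auto simp: \<epsilon>_def right_diff_distrib)
  ultimately show ?thesis by (simp add: e_def)
qed

lemma poly_R_1: "poly (R n) 1 = 1"
proof (induction n rule: less_induct)
  case (less n)
  show ?case
  proof (cases n)
    case (Suc m)
    have "poly (R m) 1 = 1" "poly (R (m - 1)) 1 = 1" "poly (R (Suc 0)) 1 = 1"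
      using less Suc by (auto simp: R_1 simp del: qLeg.simps)
    then have "A m * poly (R (Suc m)) 1 = A m"
      using arg_cong[OF R_Suc_0_mult[of m], of "\<lambda>p. poly p 1"] by (simp del: qLeg.simps)
    then show ?thesis using A_pos[of m] Suc by (simp del: qLeg.simps)
  qed simp
qed

text \<open>\<open>R n\<close> is 1 at the point 1, so \<open>x - 1\<close> divides
  \<open>R n - 1\<close>; at a node this factor is \<open>- (q ^ k)\<close>, and the quotient is
  bounded.\<close>

lemma P_minus_1_bound:
  obtains B where "B > 0" "\<And>k. \<bar>P n k - 1\<bar> \<le> B * q ^ k"
proof -
  have "[:-1, 1:] dvd R n - 1"
    using poly_R_1[of n] by (simp add: poly_eq_0_iff_dvd[symmetric])
  then obtain p where p: "R n - 1 = [:-1, 1:] * p" by (elim dvdE)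
  obtain B where B: "B > 0" "\<And>k. \<bar>poly p (1 - q ^ k)\<bar> \<le> B" using poly_nodes_bounded[of p] by metis
  have "P n k - 1 = - (q ^ k) * poly p (1 - q ^ k)" for k
    using arg_cong[OF p, of "\<lambda>p. poly p (1 - q ^ k)"] by (simp add: P_def algebra_simps)
  then have "\<bar>P n k - 1\<bar> \<le> B * q ^ k" for k
    using B(2)[of k] q_power_pos[of k] by (simp add: abs_mult mult.commute)
  with B(1) show ?thesis by (rule that)
qed

lemma l1h_add:
  assumes "f \<in> l1h q" "g \<in> l1h q"
  shows "(\<lambda>k. f k + g k) \<in> l1h q"
proof (rule l1hI(1))
  show "h n * norm (f n + g n) \<le> norm (f n) * h n + norm (g n) * h n" for n
    using mult_left_mono[OF norm_triangle_ineq[of "f n" "g n"] less_imp_le[OF h_pos[of n]]] by (simp add: algebra_simps)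
  show "summable (\<lambda>n. norm (f n) * h n + norm (g n) * h n)"
    using assms by (intro summable_add) (simp_all add: l1h_def)
qed

lemma l1h_scale: "f \<in> l1h q \<Longrightarrow> (\<lambda>k. c * f k) \<in> l1h q"
  by (auto simp: l1h_def norm_mult mult.assoc intro: summable_mult)

lemma l1h_diff: "f \<in> l1h q \<Longrightarrow> g \<in> l1h q \<Longrightarrow> (\<lambda>k. f k - g k) \<in> l1h q"
  using l1h_add[OF _ l1h_scale[of g "-1"]] by simp

section \<open>Vanishing of a bounded derivation\<close>

context
  fixes D :: "(nat \<Rightarrow> complex) \<Rightarrow> (nat \<Rightarrow> complex)"
  assumes D: "bounded_derivation_l1h q D"
begin

lemma D_linfty: "f \<in> l1h q \<Longrightarrow> D f \<in> linfty"
  and D_add: "f \<in> l1h q \<Longrightarrow> g \<in> l1h q \<Longrightarrow> D (\<lambda>k. f k + g k) = (\<lambda>k. D f k + D g k)"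
  and D_scale: "f \<in> l1h q \<Longrightarrow> D (\<lambda>k. c * f k) = (\<lambda>k. c * D f k)"
  and D_conv: "f \<in> l1h q \<Longrightarrow> g \<in> l1h q \<Longrightarrow> D (conv q f g) = (\<lambda>n. conv q f (D g) n + conv q (D f) g n)"
  using D unfolding bounded_derivation_l1h_def by blast+

lemma D_diff: "f \<in> l1h q \<Longrightarrow> g \<in> l1h q \<Longrightarrow> D (\<lambda>k. f k - g k) = (\<lambda>k. D f k - D g k)"
  using D_add[OF _ l1h_scale[of g "-1"], of f] D_scale[of g "-1"] by simp

lemma D_zero: "D (\<lambda>_. 0) = (\<lambda>_. 0)"
  using D_scale[OF e_in_l1h, of 0] by simp

lemma D_sum:
  assumes "finite S" "\<And>i. i \<in> S \<Longrightarrow> f i \<in> l1h q" "\<And>i. i \<in> S \<Longrightarrow> D (f i) = (\<lambda>_. 0)"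
  shows "(\<lambda>m. \<Sum>i\<in>S. c i * f i m) \<in> l1h q \<and> D (\<lambda>m. \<Sum>i\<in>S. c i * f i m) = (\<lambda>_. 0)"
  using assms
proof (induction S rule: finite_induct)
  case empty
  have "(\<lambda>_. 0) \<in> l1h q" by (simp add: l1h_def)
  then show ?case by (simp add: D_zero)
next
  case (insert i S)
  then show ?case
    using D_add[of "\<lambda>m. c i * f i m" "\<lambda>m. \<Sum>i\<in>S. c i * f i m"] D_scale[of "f i" "c i"]
    by (simp add: l1h_add l1h_scale)
qed

lemma D_limit:
  assumes f: "f \<in> l1h q" and g: "\<And>N. g N \<in> l1h q" "\<And>N. D (g N) = (\<lambda>_. 0)"
    and lim: "(\<lambda>N. l1h_norm q (\<lambda>m. f m - g N m)) \<longlonglongrightarrow> 0"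
  shows "D f = (\<lambda>_. 0)"
proof
  fix n
  obtain C where C: "\<And>f n. f \<in> l1h q \<Longrightarrow> norm (D f n) \<le> C * l1h_norm q f"
    using D unfolding bounded_derivation_l1h_def by blast
  have "norm (D f n) \<le> C * l1h_norm q (\<lambda>m. f m - g N m)" for N
    using C[OF l1h_diff[OF f g(1)], of N n] by (simp add: D_diff f g)
  moreover have "(\<lambda>N. C * l1h_norm q (\<lambda>m. f m - g N m)) \<longlonglongrightarrow> C * 0"
    by (intro tendsto_mult tendsto_const lim)
  ultimately have "norm (D f n) \<le> C * 0"
    by (intro LIMSEQ_le_const) auto
  then show "D f n = 0" by simp
qed

text \<open>The convolution square of \<open>e k\<close> is \<open>l\<close> times
  \<open>e k\<close>, so the Leibniz rule gives \<open>l * \<phi> n = 2 * x * e k n\<close>. Pairing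
  with \<open>e k\<close> yields \<open>l * x = 2 * x * l\<close>, hence
  \<open>x = 0\<close>.\<close>

lemma D_e: "D (e k) = (\<lambda>_. 0)"
proof
  fix n
  define \<phi> where "\<phi> = D (e k)"
  define x where "x = pairing \<phi> (e k)"
  define l where "l = pairing (e k) (e k)"
  have \<phi>: "\<phi> \<in> linfty" unfolding \<phi>_def by (intro D_linfty e_in_l1h)
  have "conv q (e k) (e k) = (\<lambda>n. l * e k n)"
    by (rule ext) (simp add: conv_e_left e_in_linfty l_def e_def)
  then have "D (conv q (e k) (e k)) = (\<lambda>n. l * \<phi> n)"
    using D_scale[OF e_in_l1h, of l k] by (simp add: \<phi>_def)
  then have "(\<lambda>n. l * \<phi> n) = (\<lambda>n. conv q (e k) \<phi> n + conv q \<phi> (e k) n)"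
    unfolding D_conv[OF e_in_l1h e_in_l1h] \<phi>_def by simp
  then have eq: "l * \<phi> n = 2 * x * e k n" for n
    unfolding conv_e_left[OF \<phi>] conv_e_right[OF \<phi>] by (simp add: fun_eq_iff x_def e_def)
  have "(\<lambda>m. l * (\<phi> m * e k m * of_real (h m))) sums (l * x)"
    unfolding x_def by (intro sums_mult pairing_sums \<phi> e_in_l1h)
  moreover have "(\<lambda>m. 2 * x * (e k m * e k m * of_real (h m))) sums (2 * x * l)"
    unfolding l_def by (intro sums_mult pairing_sums e_in_linfty e_in_l1h)
  moreover have "l * (\<phi> m * e k m * of_real (h m)) = 2 * x * (e k m * e k m * of_real (h m))" for m
    by (simp only: eq mult.assoc[symmetric])
  ultimately have "l * x = 2 * x * l" using sums_unique2 by force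
  moreover have "l \<noteq> 0" unfolding l_def by (rule pairing_e_e_nonzero)
  ultimately have "x = 0" by simp
  with eq[of n] \<open>l \<noteq> 0\<close> show "D (e k) n = 0" by (simp add: \<phi>_def)
qed

lemma D_\<epsilon>_0: "D (\<epsilon> 0) = (\<lambda>_. 0)"
proof -
  have "conv q (\<epsilon> 0) (\<epsilon> 0) = \<epsilon> 0" by (rule ext) (rule conv_\<epsilon>_0_left)
  then have "D (\<epsilon> 0) = (\<lambda>n. D (\<epsilon> 0) n + D (\<epsilon> 0) n)"
    using D_conv[OF \<epsilon>_in_l1h \<epsilon>_in_l1h, of 0 0] by (simp add: conv_\<epsilon>_0_left conv_\<epsilon>_0_right)
  then show ?thesis by (simp add: fun_eq_iff)
qed

lemma D_\<epsilon>: "D (\<epsilon> n) = (\<lambda>_. 0)"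
proof -
  define s where "s = sqrt q"
  define c where "c k = (of_real ((1 - q) * q ^ k * (P n k - 1)) :: complex)" for k
  define f where "f = (\<lambda>m. \<epsilon> n m - \<epsilon> 0 m)"
  define g where "g N = (\<lambda>m. \<Sum>k<N. c k * e k m)" for N
  have s: "0 < s" "s < 1" using sqrt_q by (simp_all add: s_def)
  have f: "f \<in> l1h q" unfolding f_def by (intro l1h_diff \<epsilon>_in_l1h)
  obtain K where K: "K > 0" "\<And>n k. h n * \<bar>P n k\<bar> \<le> K * (s ^ n / s ^ (3 * k))"
    using P_bound_improved unfolding s_def by metis
  obtain B where B: "B > 0" "\<And>k. \<bar>P n k - 1\<bar> \<le> B * q ^ k" using P_minus_1_bound by metis
  \<comment> \<open>Two factors \<open>q ^ k\<close>, from the weight and from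
    \<open>P_minus_1_bound\<close>, make \<open>s ^ (4 * k)\<close>, which beats the denominator
    \<open>s ^ (3 * k)\<close>; the weight alone would give only \<open>s ^ (2 * k)\<close>.\<close>
  have coefficient: "h m * norm (c k * e k m) \<le> B * K * s ^ m * s ^ k" for m k
  proof -
    have q: "q ^ k = s ^ (2 * k)" by (simp add: s_def sqrt_q)
    have "norm (c k) \<le> 1 * q ^ k * (B * q ^ k)"
      unfolding c_def norm_of_real abs_mult using q_pos q_less_1
      by (intro mult_mono B) auto
    then have "norm (c k) * (h m * \<bar>P m k\<bar>) \<le> (1 * q ^ k * (B * q ^ k)) * (K * (s ^ m / s ^ (3 * k)))"
      using B(1) q_power_pos[of k] h_pos[of m] by (intro mult_mono K) auto
    also have "\<dots> = B * K * s ^ m * ((s ^ (2 * k) * s ^ (2 * k)) / s ^ (3 * k))"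
      by (simp add: q ac_simps)
    also have "s ^ (2 * k) * s ^ (2 * k) = s ^ (3 * k) * s ^ k"
      by (simp flip: power_add)
    finally have "norm (c k) * (h m * \<bar>P m k\<bar>) \<le> B * K * s ^ m * s ^ k"
      using s by simp
    then show ?thesis by (simp add: norm_mult e_def ac_simps)
  qed
  have geo: "summable (\<lambda>k. s ^ k)" "(\<Sum>k. s ^ k) = 1 / (1 - s)"
    using s by (simp_all add: summable_geometric suminf_geometric)
  \<comment> \<open>The error at \<open>m\<close> is a tail of the pointwise series; its bound is
    geometric in both \<open>N\<close> and \<open>m\<close>, so summing over \<open>m\<close>
    controls the norm.\<close>
  have tail: "h m * norm (f m - g N m) \<le> B * K * s ^ N / (1 - s) * s ^ m" for m N
  proof -
    have "(\<lambda>k. c (k + N) * e (k + N) m) sums (f m - g N m)"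
      using \<epsilon>_expansion[of n m] unfolding f_def g_def c_def by (rule sums_split_initial_segment)
    then have 1: "(\<lambda>k. of_real (h m) * (c (k + N) * e (k + N) m)) sums (of_real (h m) * (f m - g N m))"
      by (rule sums_mult)
    have "h m * norm (f m - g N m) = norm (of_real (h m) * (f m - g N m))"
      using h_pos[of m] by (simp add: norm_mult)
    also have "\<dots> \<le> (\<Sum>k. B * K * s ^ m * s ^ N * s ^ k)"
      unfolding sums_unique[OF 1]
    proof (rule norm_suminf_le)
      show "summable (\<lambda>k. B * K * s ^ m * s ^ N * s ^ k)" by (intro summable_mult geo)
      show "norm (of_real (h m) * (c (k + N) * e (k + N) m)) \<le> B * K * s ^ m * s ^ N * s ^ k" for k
        using coefficient[of m "k + N"] h_pos[of m] by (simp add: norm_mult power_add ac_simps)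
    qed
    also have "\<dots> = B * K * s ^ N / (1 - s) * s ^ m"
      by (subst suminf_mult) (use s in \<open>simp_all add: geo\<close>)
    finally show ?thesis .
  qed
  have norm_le: "l1h_norm q (\<lambda>m. f m - g N m) \<le> B * K / (1 - s)\<^sup>2 * s ^ N" for N
  proof -
    have "l1h_norm q (\<lambda>m. f m - g N m) \<le> (\<Sum>m. B * K * s ^ N / (1 - s) * s ^ m)"
      by (rule l1hI(2)[OF tail]) (intro summable_mult geo)
    also have "\<dots> = B * K / (1 - s)\<^sup>2 * s ^ N"
      by (subst suminf_mult) (use s in \<open>simp_all add: geo power2_eq_square\<close>)
    finally show ?thesis .
  qed
  have g: "g N \<in> l1h q" "D (g N) = (\<lambda>_. 0)" for N
    using D_sum[of "{..<N}" e c] unfolding g_def by (simp_all add: e_in_l1h D_e)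
  have "(\<lambda>N. l1h_norm q (\<lambda>m. f m - g N m)) \<longlonglongrightarrow> 0"
  proof (rule tendsto_sandwich[of "\<lambda>_. 0"])
    have "summable (\<lambda>m. norm (f m - g N m) * h m)" for N
      using l1h_diff[OF f g(1)] by (simp add: l1h_def)
    then show "\<forall>\<^sub>F N in sequentially. 0 \<le> l1h_norm q (\<lambda>m. f m - g N m)"
      unfolding l1h_norm_def by (intro always_eventually allI suminf_nonneg) (auto simp: less_imp_le[OF h_pos])
    show "\<forall>\<^sub>F N in sequentially. l1h_norm q (\<lambda>m. f m - g N m) \<le> B * K / (1 - s)\<^sup>2 * s ^ N"
      by (intro always_eventually allI norm_le)
    have "(\<lambda>N. B * K / (1 - s)\<^sup>2 * s ^ N) \<longlonglongrightarrow> B * K / (1 - s)\<^sup>2 * 0"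
      using s by (intro tendsto_mult tendsto_const LIMSEQ_realpow_zero) auto
    then show "(\<lambda>N. B * K / (1 - s)\<^sup>2 * s ^ N) \<longlonglongrightarrow> 0" by simp
  qed simp
  then have Df: "D f = (\<lambda>_. 0)" by (rule D_limit[OF f g])
  then have "(\<lambda>m. D (\<epsilon> n) m - D (\<epsilon> 0) m) = (\<lambda>_. 0)"
    using D_diff[OF \<epsilon>_in_l1h \<epsilon>_in_l1h, of n 0] by (simp add: f_def)
  then show ?thesis by (simp add: D_\<epsilon>_0)
qed

lemma D_eq_0:
  assumes f: "f \<in> l1h q"
  shows "D f = (\<lambda>_. 0)"
proof -
  define a where "a m = norm (f m) * h m" for m
  \<comment> \<open>The factor \<open>h n\<close> cancels the normalization of
    \<open>\<epsilon> n\<close>, so \<open>g N\<close> is \<open>f\<close> cut off at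
    \<open>N\<close>.\<close>
  define g where "g N = (\<lambda>m. \<Sum>n<N. (f n * of_real (h n)) * \<epsilon> n m)" for N
  have a: "summable a" using f by (simp add: l1h_def a_def[abs_def])
  have g: "g N \<in> l1h q" "D (g N) = (\<lambda>_. 0)" for N
    using D_sum[of "{..<N}" \<epsilon> "\<lambda>n. f n * of_real (h n)"] unfolding g_def by (simp_all add: \<epsilon>_in_l1h D_\<epsilon>)
  have g_eq: "g N m = (if m < N then f m else 0)" for N m
    using h_pos[of m] by (simp add: g_def \<epsilon>_def if_distrib[of "\<lambda>x. _ * x"] cong: if_cong)
  have "l1h_norm q (\<lambda>m. f m - g N m) = suminf a - sum a {..<N}" for N
  proof -
    have "(\<lambda>m. a m - (if m \<in> {..<N} then a m else 0)) sums (suminf a - sum a {..<N})"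
      by (intro sums_diff summable_sums a sums_If_finite_set) simp
    moreover have "a m - (if m \<in> {..<N} then a m else 0) = norm (f m - g N m) * h m" for m
      by (simp add: g_eq a_def)
    ultimately show ?thesis unfolding l1h_norm_def by (simp add: sums_iff)
  qed
  moreover have "(\<lambda>N. suminf a - sum a {..<N}) \<longlonglongrightarrow> suminf a - suminf a"
    by (intro tendsto_diff tendsto_const summable_LIMSEQ a)
  ultimately show ?thesis
    by (intro D_limit[OF f g]) simp
qed

end

end

theorem theorem4p4:
  fixes q :: real
  assumes "0 < q" and "q < 1"
  shows "weakly_amenable_l1h q"
  unfolding weakly_amenable_l1h_def
proof (intro allI impI)
  interpret little_q_Legendre q using assms by unfold_locales
  fix D assume D: "bounded_derivation_l1h q D"
  have "conv q f (\<lambda>_. 0) n = 0" "conv q (\<lambda>_. 0) f n = 0" for f n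
    by (simp_all add: conv_def transl_def)
  \<comment> \<open>Inner derivations are zero here, so the zero sequence serves as witness once
    \<open>D\<close> vanishes.\<close>
  then show "inner_derivation_l1h q D"
    unfolding inner_derivation_l1h_def using D_eq_0[OF D]
    by (intro bexI[of _ "\<lambda>_. 0"]) (auto simp: linfty_def)
qed

end
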